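(* Let $N\ge 2$ be an integer. For $\beta\in\mathbb{R}$ let $$I_\beta(v)=\int_0^1 e^{\beta\,\log\frac{e}{s}\,\frac{|v(s)|^N}{s^{N-1}}}\,ds .$$ Then $$\sup_{v\in E_N} I_\beta(v)<\infty\iff \beta\le 1 .$$ Moreover: (i) for $\beta<1$ the functional $I_\beta$ is weakly continuous on $E_N$, i.e. for any sequence $\{u_n\}\subset E_N$ with $u_n\rightharpoonup u$ weakly in $W^{1,N}(0,1)$ one has $I_\beta(u_n)\to I_\beta(u)$; (ii) for $\beta=1$ the functional $I_1$ is weakly continuous along the infinitesimal Moser sequence $\{w_j\}$, i.e. $I_1(w_j)\to 1=I_1(0)$ as $j\to\infty$; (iii) for $\beta>1$, $I_\beta(w_j)\to+\infty$ as $j\to\infty$.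
   Context: $E_N:=\left\{u\in W^{1,N}(0,1): u(0)=0,\ \int_0^1|u'|^N\,dx=1\right\}$ (real-valued functions, identified with their continuous representatives). The infinitesimal Moser sequence $\{w_j\}_{j\ge1}$ is defined on $[0,1]$ by $w_j(t)=j^{1/N}t$ for $0\le t\le \frac1j$ and $w_j(t)=j^{-\frac{N-1}{N}}$ for $\frac1j\le t\le1$; one has $w_j\in E_N$ and $w_j\rightharpoonup 0$ weakly in $W^{1,N}(0,1)$. *)

theory Defs
  imports "HOL-Analysis.Analysis"
begin

definition test_function :: "(real \<Rightarrow> real) \<Rightarrow> bool" where
  "test_function \<phi> \<longleftrightarrow>
     (\<forall>k x. ((deriv ^^ k) \<phi>) differentiable (at x)) \<and>
     compact (closure {x. \<phi> x \<noteq> 0}) \<and> closure {x. \<phi> x \<noteq> 0} \<subseteq> {0<..<1}"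

definition locally_integrable :: "(real \<Rightarrow> real) \<Rightarrow> bool" where
  "locally_integrable f \<longleftrightarrow>
     (\<forall>K. compact K \<longrightarrow> K \<subseteq> {0<..<1} \<longrightarrow> f absolutely_integrable_on K)"

definition has_weak_deriv :: "(real \<Rightarrow> real) \<Rightarrow> (real \<Rightarrow> real) \<Rightarrow> bool" where
  "has_weak_deriv u g \<longleftrightarrow>
     locally_integrable u \<and> locally_integrable g \<and>
     (\<forall>\<phi>. test_function \<phi> \<longrightarrow>
        (LINT x|lebesgue_on {0<..<1}. u x * deriv \<phi> x) =
        - (LINT x|lebesgue_on {0<..<1}. g x * \<phi> x))"

text \<open>The weak derivative is unique only up to null sets; every use below is invariant
  under changing it on a null set.\<close>

definition weak_deriv :: "(real \<Rightarrow> real) \<Rightarrow> real \<Rightarrow> real" where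
  "weak_deriv u = (SOME g. has_weak_deriv u g)"

definition Lp_space :: "nat \<Rightarrow> (real \<Rightarrow> real) set" where
  "Lp_space p = {f \<in> borel_measurable (lebesgue_on {0<..<1}).
     integrable (lebesgue_on {0<..<1}) (\<lambda>x. \<bar>f x\<bar> ^ p)}"

text \<open>The space \<open>W\<^sup>1\<^sup>,\<^sup>p(0,1)\<close>, each class being represented by its continuous representative
  on \<open>[0,1]\<close>. Values outside \<open>[0,1]\<close> are irrelevant.\<close>

definition sobolev :: "nat \<Rightarrow> (real \<Rightarrow> real) set" where
  "sobolev p = {u. continuous_on {0..1} u \<and> u \<in> Lp_space p \<and>
     (\<exists>g. has_weak_deriv u g \<and> g \<in> Lp_space p)}"

definition sobolev_norm :: "nat \<Rightarrow> (real \<Rightarrow> real) \<Rightarrow> real" where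
  "sobolev_norm p u =
     root p ((LINT x|lebesgue_on {0<..<1}. \<bar>u x\<bar> ^ p) +
             (LINT x|lebesgue_on {0<..<1}. \<bar>weak_deriv u x\<bar> ^ p))"

text \<open>The dual space. Boundedness forces a functional to take equal values on functions that
  agree on \<open>[0,1]\<close>, so these are exactly the functionals on the quotient.\<close>

definition sobolev_dual :: "nat \<Rightarrow> ((real \<Rightarrow> real) \<Rightarrow> real) set" where
  "sobolev_dual p = {L.
     (\<forall>f\<in>sobolev p. \<forall>g\<in>sobolev p. \<forall>a b. L (\<lambda>x. a * f x + b * g x) = a * L f + b * L g) \<and>
     (\<exists>C. \<forall>f\<in>sobolev p. \<bar>L f\<bar> \<le> C * sobolev_norm p f)}"

definition sobolev_weak_conv :: "nat \<Rightarrow> (nat \<Rightarrow> real \<Rightarrow> real) \<Rightarrow> (real \<Rightarrow> real) \<Rightarrow> bool" where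
  "sobolev_weak_conv p U u \<longleftrightarrow>
     (\<forall>n. U n \<in> sobolev p) \<and> u \<in> sobolev p \<and>
     (\<forall>L\<in>sobolev_dual p. (\<lambda>n. L (U n)) \<longlonglongrightarrow> L u)"

definition E_space :: "nat \<Rightarrow> (real \<Rightarrow> real) set" where
  "E_space N = {u \<in> sobolev N. u 0 = 0 \<and>
     (LINT x|lebesgue_on {0<..<1}. \<bar>weak_deriv u x\<bar> ^ N) = 1}"

text \<open>The integrand is positive, so the integral is taken in \<open>[0,\<infinity>]\<close>; the value \<open>\<infinity>\<close> is not
  excluded a priori.\<close>

definition I_fun :: "nat \<Rightarrow> real \<Rightarrow> (real \<Rightarrow> real) \<Rightarrow> ennreal" where
  "I_fun N \<beta> v =
     (\<integral>\<^sup>+ s. ennreal (exp (\<beta> * ln (exp 1 / s) * (\<bar>v s\<bar> ^ N / s ^ (N - 1))))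
        \<partial>lebesgue_on {0<..<1})"

text \<open>The sequence is meant for \<open>j \<ge> 1\<close>; the value at \<open>j = 0\<close> is junk and only limits in \<open>j\<close>
  are considered.\<close>

definition moser :: "nat \<Rightarrow> nat \<Rightarrow> real \<Rightarrow> real" where
  "moser N j t =
     (if t \<le> 1 / real j then real j powr (1 / real N) * t
      else real j powr (- ((real N - 1) / real N)))"

end

theory Submission
  imports Defs "HOL-Real_Asymp.Real_Asymp"
begin

text \<open>Write \<open>f(s) = \<bar>v(s)\<bar>\<^sup>N / s\<^bsup>N-1\<^esup>\<close>, so that the integrand is \<open>(e/s)\<^bsup>\<beta> f(s)\<^esup>\<close>. Hoelder's inequality gives
  \<open>f \<le> 1\<close> on \<open>E\<^sub>N\<close>, hence the integrable majorant \<open>(e/s)\<^bsup>max \<beta> 0\<^esup>\<close> for \<open>\<beta> < 1\<close>, and weak convergence implies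
  pointwise convergence because point evaluations lie in the dual.
  For \<open>\<beta> = 1\<close> fix a small \<open>\<epsilon>\<close>. If \<open>f(x) \<ge> 1 - \<epsilon>\<close>, almost all of the energy sits on \<open>(0,x)\<close>, so \<open>f\<close> is small again
  beyond \<open>K x\<close>, with \<open>K\<close> depending only on \<open>N\<close>. Thus \<open>{f \<ge> 1 - \<epsilon>}\<close> lies in an interval \<open>[s\<^sub>0/K, K s\<^sub>0]\<close>, on which
  the integral of \<open>e/s\<close> is bounded independently of \<open>s\<^sub>0\<close>; off it \<open>(e/s)\<^bsup>1-\<epsilon>\<^esup>\<close> is an integrable majorant.
  For the Moser functions \<open>f(s)\<close> is \<open>js\<close> on \<open>(0,1/j]\<close> and \<open>(js)\<^bsup>-(N-1)\<^esup>\<close> afterwards, so everything happens near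
  \<open>s = 1/j\<close>: the window \<open>\<bar>js - 1\<bar> < \<delta>\<close> contributes at most \<open>4e\<delta>\<close> if \<open>\<beta> = 1\<close>, and at least
  \<open>\<delta> j\<^bsup>\<beta>(1-\<delta>)-1\<^esup>\<close> if \<open>\<beta> > 1\<close>.\<close>

section \<open>Smooth step functions\<close>

text \<open>The regularity clause of \<open>test_function\<close> on its own. Its shape is kept, so
  that test functions can be assembled from smooth pieces by unfolding alone.\<close>

definition smooth :: "(real \<Rightarrow> real) \<Rightarrow> bool" where
  "smooth f \<longleftrightarrow> (\<forall>k x. ((deriv ^^ k) f) differentiable (at x))"

lemma deriv_eqI: "(\<And>x. (f has_real_derivative f' x) (at x)) \<Longrightarrow> deriv f = f'"
  by (auto intro: DERIV_imp_deriv)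

lemma smooth_has_deriv:
  assumes "smooth f"
  shows "(f has_real_derivative deriv f x) (at x)"
  using assms[unfolded smooth_def, rule_format, of 0 x]
  by (metis DERIV_deriv_iff_real_differentiable funpow_0)

lemma smooth_deriv: "smooth f \<Longrightarrow> smooth (deriv f)"
  unfolding smooth_def by (metis comp_apply funpow_Suc_right)

lemma smooth_continuous_on: "smooth f \<Longrightarrow> continuous_on A f"
  by (meson DERIV_isCont continuous_at_imp_continuous_on smooth_has_deriv)

text \<open>A set of functions closed under differentiation contains all iterated derivatives of its
  members. This replaces explicit formulas for higher derivatives by the choice of a suitable
  invariant set \<open>S\<close>.\<close>

lemma smooth_coinduct:
  assumes "f \<in> S"
    and step: "\<And>f. f \<in> S \<Longrightarrow> \<exists>f'\<in>S. \<forall>x. (f has_real_derivative f' x) (at x)"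
  shows "smooth f"
proof -
  have "(deriv ^^ k) f \<in> S" for k
  proof (induction k)
    case (Suc k)
    then show ?case using step[OF Suc] deriv_eqI by fastforce
  qed (use assms in simp)
  then show ?thesis
    unfolding smooth_def using step real_differentiable_def by blast
qed

lemma smooth_antideriv:
  assumes "\<And>x. (F has_real_derivative f x) (at x)" "smooth f"
  shows "smooth F"
proof (rule smooth_coinduct[of F "insert F {g. smooth g}"])
  show "\<exists>f'\<in>insert F {g. smooth g}. \<forall>x. (g has_real_derivative f' x) (at x)"
    if "g \<in> insert F {g. smooth g}" for g
    using that assms smooth_has_deriv smooth_deriv by blast
qed simp

lemma smooth_diff:
  assumes "smooth f" "smooth g"
  shows "smooth (\<lambda>x. f x - g x)"
proof (rule smooth_coinduct[of _ "{\<lambda>x. f x - g x |f g. smooth f \<and> smooth g}"])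
  show "\<exists>f'\<in>{\<lambda>x. f x - g x |f g. smooth f \<and> smooth g}. \<forall>x. (h has_real_derivative f' x) (at x)"
    if "h \<in> {\<lambda>x. f x - g x |f g. smooth f \<and> smooth g}" for h
  proof -
    obtain f g where fg: "h = (\<lambda>x. f x - g x)" "smooth f" "smooth g"
      using \<open>h \<in> _\<close> by blast
    show ?thesis
      unfolding fg(1)
      by (rule bexI[of _ "\<lambda>x. deriv f x - deriv g x"])
        (use fg in \<open>auto intro!: derivative_eq_intros smooth_has_deriv smooth_deriv\<close>)
  qed
qed (use assms in blast)

text \<open>The family of all \<open>bump a b p k\<close> is closed under differentiation, and \<open>bump a b 1 0\<close> is
  the usual bump function on \<open>(a, b)\<close>.\<close>

definition bump :: "real \<Rightarrow> real \<Rightarrow> real poly \<Rightarrow> nat \<Rightarrow> real \<Rightarrow> real" where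
  "bump a b p k x =
     (if a < x \<and> x < b
      then poly p x / ((x - a) * (b - x)) ^ k * exp (- 1 / ((x - a) * (b - x))) else 0)"

text \<open>The term of index \<open>k + 2\<close> in the exponential series at \<open>1 / q\<close>
  is a lower bound for the whole sum. Of its powers, \<open>k\<close> compensate the division by
  \<open>q ^ k\<close>, and the other two leave a factor \<open>q ^ 2\<close>.\<close>

lemma exp_inverse_decay:
  fixes q :: real
  assumes "q > 0"
  shows "exp (- 1 / q) / q ^ k \<le> fact (k + 2) * q ^ 2"
proof -
  define y where "y = 1 / q"
  have y: "y \<ge> 0" using assms by (simp add: y_def)
  have "(\<Sum>n\<in>{k + 2}. y ^ n /\<^sub>R fact n) \<le> (\<Sum>n. y ^ n /\<^sub>R fact n)"
    by (rule sum_le_suminf[OF summable_exp_generic]) (use y in auto)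
  then have "y ^ (k + 2) / fact (k + 2) \<le> exp y"
    by (simp add: exp_def divide_inverse mult.commute del: power_Suc fact_Suc)
  then have "y ^ (k + 2) \<le> fact (k + 2) * exp y"
    by (simp add: divide_le_eq mult.commute del: power_Suc fact_Suc)
  then have "y ^ (k + 2) * exp (- y) \<le> fact (k + 2) * exp y * exp (- y)"
    by (rule mult_right_mono) simp
  then have "y ^ (k + 2) * exp (- y) \<le> fact (k + 2)"
    by (simp add: mult.assoc flip: exp_add del: power_Suc fact_Suc)
  then have "q ^ 2 * (y ^ (k + 2) * exp (- y)) \<le> q ^ 2 * fact (k + 2)"
    by (rule mult_left_mono) simp
  moreover have "q ^ 2 * (y ^ (k + 2) * exp (- y)) = exp (- 1 / q) / q ^ k"
    using assms by (simp add: y_def power_add power_divide power2_eq_square)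
  ultimately show ?thesis by (simp add: mult.commute del: fact_Suc)
qed

lemma quadratic_bound_imp_has_derivative_0:
  fixes f :: "real \<Rightarrow> real"
  assumes "\<And>x. \<bar>f x\<bar> \<le> C * (x - c) ^ 2"
  shows "(f has_real_derivative 0) (at c)"
proof -
  have f0: "f c = 0" using assms[of c] by simp
  have "((\<lambda>h. (f (c + h) - f c) / h) \<longlongrightarrow> 0) (at 0)"
  proof (rule Lim_null_comparison)
    show "\<forall>\<^sub>F h in at 0. norm ((f (c + h) - f c) / h) \<le> C * \<bar>h\<bar>"
    proof (rule eventually_at_topological[THEN iffD2], intro exI[of _ UNIV] conjI ballI impI)
      fix h :: real assume "h \<noteq> 0"
      then show "norm ((f (c + h) - f c) / h) \<le> C * \<bar>h\<bar>"
        using assms[of "c + h"] f0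
        by (simp add: divide_le_eq power2_eq_square mult.assoc flip: abs_mult)
    qed auto
    show "((\<lambda>h::real. C * \<bar>h\<bar>) \<longlongrightarrow> 0) (at 0)"
      by (auto intro!: tendsto_eq_intros)
  qed
  then show ?thesis by (simp add: DERIV_def)
qed

text \<open>Apply \<open>exp_inverse_decay\<close> to \<open>q = (x - a) * (b - x)\<close>, with
  \<open>p\<close> bounded by compactness, and estimate one of the two factors by
  \<open>b - a\<close>. Second-order vanishing at both ends is what makes \<open>bump\<close>
  differentiable there.\<close>

lemma bump_quadratic_bound:
  assumes "a < b"
  obtains C where "\<And>x. \<bar>bump a b p k x\<bar> \<le> C * (x - a) ^ 2" "\<And>x. \<bar>bump a b p k x\<bar> \<le> C * (x - b) ^ 2"
proof -
  have "compact (poly p ` {a..b})"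
    by (intro compact_continuous_image continuous_intros) auto
  then obtain M where M: "\<And>x. x \<in> {a..b} \<Longrightarrow> \<bar>poly p x\<bar> \<le> M"
    by (metis compact_imp_bounded bounded_iff imageI real_norm_def)
  have M0: "M \<ge> 0" using M[of a] assms by auto
  define C where "C = M * fact (k + 2) * (b - a) ^ 2"
  have main: "\<bar>bump a b p k x\<bar> \<le> M * fact (k + 2) * ((x - a) * (b - x)) ^ 2" if x: "a < x" "x < b" for x
  proof -
    define q where "q = (x - a) * (b - x)"
    have q: "q > 0" unfolding q_def using x by auto
    have "\<bar>bump a b p k x\<bar> = \<bar>poly p x\<bar> * (exp (- 1 / q) / q ^ k)"
      using x q by (simp add: bump_def abs_mult flip: q_def)
    also have "\<dots> \<le> M * (fact (k + 2) * q ^ 2)"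
      by (intro mult_mono exp_inverse_decay M) (use x q M0 in auto)
    finally show ?thesis by (simp add: q_def mult.assoc)
  qed
  show thesis
  proof (rule that[of C])
    fix x
    show "\<bar>bump a b p k x\<bar> \<le> C * (x - a) ^ 2"
    proof (cases "a < x \<and> x < b")
      case True
      have "((x - a) * (b - x)) ^ 2 \<le> (x - a) ^ 2 * (b - a) ^ 2"
        using True by (auto simp: power_mult_distrib intro!: mult_left_mono power_mono)
      then have "M * fact (k + 2) * ((x - a) * (b - x)) ^ 2 \<le> M * fact (k + 2) * ((x - a) ^ 2 * (b - a) ^ 2)"
        by (rule mult_left_mono) (use M0 in auto)
      then show ?thesis using main[of x] True unfolding C_def by (simp add: mult_ac)
    qed (use M0 in \<open>auto simp: bump_def C_def\<close>)
    show "\<bar>bump a b p k x\<bar> \<le> C * (x - b) ^ 2"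
    proof (cases "a < x \<and> x < b")
      case True
      have "((x - a) * (b - x)) ^ 2 \<le> (b - a) ^ 2 * (x - b) ^ 2"
        using True by (auto simp: power_mult_distrib power2_commute[of x b] intro!: mult_right_mono power_mono)
      then have "M * fact (k + 2) * ((x - a) * (b - x)) ^ 2 \<le> M * fact (k + 2) * ((b - a) ^ 2 * (x - b) ^ 2)"
        by (rule mult_left_mono) (use M0 in auto)
      then show ?thesis using main[of x] True unfolding C_def by (simp add: mult_ac)
    qed (use M0 in \<open>auto simp: bump_def C_def\<close>)
  qed
qed

text \<open>Inside the interval this is the quotient and chain rule, with all terms brought over the
  common denominator \<open>q ^ (k + 2)\<close>. Outside, the function is locally zero, and at the
  two ends the quadratic bound forces derivative 0.\<close>

lemma bump_has_derivative:
  fixes p :: "real poly"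
  assumes "a < b"
  defines "q \<equiv> [:- a, 1:] * [:b, - 1:]"
  shows "(bump a b p k has_real_derivative
           bump a b (pderiv p * q ^ 2 - smult (real k) (p * pderiv q * q) + p * pderiv q) (k + 2) x) (at x)"
    (is "(_ has_real_derivative ?g x) _")
proof -
  have q: "poly q t = (t - a) * (b - t)" for t by (simp add: q_def algebra_simps)
  consider "x < a" | "x = a" | "a < x \<and> x < b" | "x = b" | "x > b" by linarith
  then show ?thesis
  proof cases
    case 1
    have "eventually (\<lambda>t. bump a b p k t = 0) (nhds x)"
      using eventually_nhds_in_open[of "{..<a}" x] 1 by (auto elim!: eventually_mono simp: bump_def)
    then have "(bump a b p k has_real_derivative 0) (at x)"
      by (subst DERIV_cong_ev[OF refl _ refl]) auto
    then show ?thesis using 1 by (simp add: bump_def)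
  next
    case 5
    have "eventually (\<lambda>t. bump a b p k t = 0) (nhds x)"
      using eventually_nhds_in_open[of "{b<..}" x] 5 by (auto elim!: eventually_mono simp: bump_def)
    then have "(bump a b p k has_real_derivative 0) (at x)"
      by (subst DERIV_cong_ev[OF refl _ refl]) auto
    then show ?thesis using 5 by (simp add: bump_def)
  next
    case 2
    then have "?g x = 0" by (simp add: bump_def)
    then show ?thesis
      using bump_quadratic_bound[OF assms(1)] quadratic_bound_imp_has_derivative_0 2 by metis
  next
    case 4
    then have "?g x = 0" by (simp add: bump_def)
    then show ?thesis
      using bump_quadratic_bound[OF assms(1)] quadratic_bound_imp_has_derivative_0 4 by metis
  next
    case 3
    then have qx: "poly q x > 0" by (simp add: q)
    have D: "((\<lambda>t. poly p t / poly q t ^ k * exp (- 1 / poly q t)) has_real_derivative ?g x) (at x)"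
    proof -
      have g: "?g x = (poly (pderiv p) x * poly q x ^ 2 - real k * (poly p x * poly (pderiv q) x * poly q x)
          + poly p x * poly (pderiv q) x) / poly q x ^ (k + 2) * exp (- 1 / poly q x)"
        using 3 by (simp add: bump_def q)
      show ?thesis
        unfolding g
        apply (rule derivative_eq_intros poly_DERIV refl | use qx in force)+
        using qx by (cases k) (simp_all add: field_simps power2_eq_square)
    qed
    have ev: "eventually (\<lambda>t. bump a b p k t = poly p t / poly q t ^ k * exp (- 1 / poly q t)) (nhds x)"
      using eventually_nhds_in_open[of "{a<..<b}" x] 3
      by (auto elim!: eventually_mono simp: bump_def q)
    show ?thesis
      using D by (subst DERIV_cong_ev[OF refl ev refl])
  qed
qed

lemma smooth_bump:
  assumes "a < b"
  shows "smooth (bump a b p k)"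
proof (rule smooth_coinduct[of _ "{bump a b p k |p k. True}"])
  show "\<exists>f'\<in>{bump a b p k |p k. True}. \<forall>x. (f has_real_derivative f' x) (at x)"
    if "f \<in> {bump a b p k |p k. True}" for f
    using that bump_has_derivative[OF assms] by blast
qed blast

text \<open>A primitive of the bump function is constant on either side of \<open>(a, b)\<close> and
  nondecreasing; subtracting its value at \<open>a\<close> and dividing by its total increase
  normalises it.\<close>

lemma smooth_step_exists:
  assumes "a < (b::real)"
  obtains S where "smooth S" "\<And>t. t \<le> a \<Longrightarrow> S t = 0" "\<And>t. t \<ge> b \<Longrightarrow> S t = 1" "mono S"
proof -
  define B where "B = bump a b 1 0"
  have smB: "smooth B" unfolding B_def by (rule smooth_bump[OF assms])
  \<comment> \<open>The extended interval from minus to plus infinity yields a single primitive on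
    the whole line.\<close>
  have "\<exists>F. \<forall>x. -\<infinity> < ereal x \<longrightarrow> ereal x < \<infinity> \<longrightarrow> (F has_vector_derivative B x) (at x)"
    by (rule einterval_antiderivative)
      (use smooth_has_deriv[OF smB] in \<open>auto intro: DERIV_isCont\<close>)
  then obtain F where F: "\<And>x. (F has_real_derivative B x) (at x)"
    by (auto simp: has_real_derivative_iff_has_vector_derivative)
  have smF: "smooth F" using smooth_antideriv[OF F smB] .
  have B0: "B x \<ge> 0" for x by (auto simp: B_def bump_def)
  have mF: "F x \<le> F y" if "x \<le> y" for x y
    by (rule DERIV_nonneg_imp_nondecreasing[OF that]) (use F B0 in blast)
  have Fa: "F t = F a" if "t \<le> a" for t
  proof (cases "t = a")
    case False
    then have "t < a" using that by simp
    from MVT2[OF this, of F B] F obtain z where "t < z" "z < a" "F a - F t = (a - t) * B z" by blast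
    then show ?thesis by (simp add: B_def bump_def)
  qed simp
  have Fb: "F t = F b" if "t \<ge> b" for t
  proof (cases "t = b")
    case False
    then have "b < t" using that by simp
    from MVT2[OF this, of F B] F obtain z where "b < z" "z < t" "F t - F b = (t - b) * B z" by blast
    then show ?thesis by (simp add: B_def bump_def)
  qed simp
  define c where "c = F b - F a"
  from MVT2[OF assms, of F B] F obtain z where "a < z" "z < b" "F b - F a = (b - a) * B z" by blast
  then have c: "c > 0" using assms by (simp add: c_def B_def bump_def)
  define S where "S t = (F t - F a) / c" for t
  \<comment> \<open>The derivative of \<open>S\<close> is the bump divided by \<open>c\<close>,
    which is again a member of the \<open>bump\<close> family, with constant polynomial
    \<open>1 / c\<close>.\<close>
  have "smooth S"
  proof (rule smooth_antideriv)
    show "(S has_real_derivative bump a b [:1 / c:] 0 x) (at x)" for x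
      unfolding S_def using F[of x] c
      by (auto intro!: derivative_eq_intros simp: B_def bump_def)
  qed (rule smooth_bump[OF assms])
  moreover have "S t = 0" if "t \<le> a" for t using Fa[OF that] by (simp add: S_def)
  moreover have "S t = 1" if "t \<ge> b" for t using Fb[OF that] c by (simp add: S_def c_def)
  moreover have "mono S" unfolding S_def using c mF by (auto intro!: monoI divide_right_mono)
  ultimately show thesis using that by blast
qed

section \<open>Weak derivatives of continuous functions\<close>

lemma integrable_unit_interval_iff:
  fixes f :: "real \<Rightarrow> real"
  shows "integrable (lebesgue_on {0<..<1}) f \<longleftrightarrow> set_integrable lebesgue {0<..<1} f"
  by (simp add: set_integrable_def integrable_restrict_space)

lemma LINT_unit_interval:
  fixes f :: "real \<Rightarrow> real"
  shows "(LINT x|lebesgue_on {0<..<1}. f x) = (LINT x:{0<..<1}|lebesgue. f x)"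
  by (simp add: set_lebesgue_integral_def integral_restrict_space)

lemma finite_measure_unit_interval: "finite_measure (lebesgue_on {0<..<1::real})"
  by (rule finite_measure_lebesgue_on) (metis lmeasurable_box box_real(1))

lemma measure_lebesgue_on_Ioo: "x < y \<Longrightarrow> measure (lebesgue_on {x<..<y}) {x<..<y::real} = y - x"
  by (simp add: measure_restrict_space)

lemma integrable_continuous_unit_interval:
  fixes f :: "real \<Rightarrow> real"
  assumes "continuous_on {0..1} f"
  shows "integrable (lebesgue_on {0<..<1}) f"
proof -
  have "set_integrable lebesgue {0..1} f"
    using absolutely_integrable_continuous_real[OF assms] .
  then have "set_integrable lebesgue {0<..<1} f"
    by (rule set_integrable_subset) auto
  then show ?thesis by (simp add: integrable_unit_interval_iff)
qed

lemma LINT_derivative: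
  fixes F f :: "real \<Rightarrow> real"
  assumes "\<And>x. (F has_real_derivative f x) (at x)" "continuous_on {0..1} f"
  shows "(LINT x|lebesgue_on {0<..<1}. f x) = F 1 - F 0"
proof -
  have "(f has_integral F 1 - F 0) {0..1}"
    by (rule fundamental_theorem_of_calculus)
      (use assms in \<open>auto simp: has_real_derivative_iff_has_vector_derivative[symmetric]
         intro: has_field_derivative_at_within\<close>)
  then have "integral {0<..<1} f = F 1 - F 0"
    by (auto simp: has_integral_Icc_iff_Ioo intro: integral_unique)
  then show ?thesis
    using lebesgue_integral_eq_integral[OF integrable_continuous_unit_interval[OF assms(2)]] by simp
qed

text \<open>The derivative of a monotone step is a nonnegative weight of total mass one that
  vanishes off \<open>[a, b]\<close>, so the integral is a weighted mean of the values of
  \<open>u\<close> there.\<close>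

lemma step_average:
  fixes u S :: "real \<Rightarrow> real"
  assumes u: "continuous_on {0..1} u" and S: "smooth S" "mono S"
    and ab: "0 \<le> a" "b \<le> 1" "\<And>t. t \<le> a \<Longrightarrow> S t = 0" "\<And>t. t \<ge> b \<Longrightarrow> S t = 1"
    and close: "\<And>t. t \<in> {a..b} \<Longrightarrow> \<bar>u t - c\<bar> \<le> e"
  shows "\<bar>(LINT t|lebesgue_on {0<..<1}. u t * deriv S t) - c\<bar> \<le> e"
proof -
  let ?M = "lebesgue_on {0<..<1::real}"
  have dS: "(S has_real_derivative deriv S t) (at t)" for t
    using smooth_has_deriv[OF S(1)] .
  have cS: "continuous_on {0..1} (deriv S)"
    by (rule smooth_continuous_on[OF smooth_deriv[OF S(1)]])
  have nonneg: "deriv S t \<ge> 0" for t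
    by (rule mono_on_imp_deriv_nonneg[of UNIV S _ t]) (use S dS in auto)
  have zero: "deriv S t = 0" if "t \<notin> {a..b}" for t
  proof -
    consider "t < a" | "t > b" using \<open>t \<notin> _\<close> by fastforce
    then show ?thesis
    proof cases
      case 1
      have "eventually (\<lambda>t. S t = 0) (nhds t)"
        using eventually_nhds_in_open[of "{..<a}" t] 1 ab by (auto elim!: eventually_mono)
      then have "(S has_real_derivative 0) (at t)"
        by (subst DERIV_cong_ev[OF refl _ refl]) auto
      then show ?thesis by (rule DERIV_imp_deriv)
    next
      case 2
      have "eventually (\<lambda>t. S t = 1) (nhds t)"
        using eventually_nhds_in_open[of "{b<..}" t] 2 ab by (auto elim!: eventually_mono)
      then have "(S has_real_derivative 0) (at t)"
        by (subst DERIV_cong_ev[OF refl _ refl]) auto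
      then show ?thesis by (rule DERIV_imp_deriv)
    qed
  qed
  have one: "(LINT t|?M. deriv S t) = 1"
    using LINT_derivative[OF dS cS] ab by simp
  have i1: "integrable ?M (\<lambda>t. u t * deriv S t)"
    by (intro integrable_continuous_unit_interval continuous_intros u cS)
  have i2: "integrable ?M (deriv S)"
    by (intro integrable_continuous_unit_interval continuous_intros u cS)
  have "(LINT t|?M. u t * deriv S t) - c = (LINT t|?M. u t * deriv S t) - (LINT t|?M. c * deriv S t)"
    using one by simp
  also have "\<dots> = (LINT t|?M. (u t - c) * deriv S t)"
    using i1 i2 by (subst Bochner_Integration.integral_diff[symmetric]) (auto simp: left_diff_distrib)
  finally have eq: "(LINT t|?M. u t * deriv S t) - c = (LINT t|?M. (u t - c) * deriv S t)" .
  have "\<bar>LINT t|?M. (u t - c) * deriv S t\<bar> \<le> (LINT t|?M. e * deriv S t)"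
  proof (rule integral_abs_bound[THEN order_trans], rule integral_mono)
    show "integrable ?M (\<lambda>t. \<bar>(u t - c) * deriv S t\<bar>)"
      by (intro integrable_continuous_unit_interval continuous_intros u cS)
    show "integrable ?M (\<lambda>t. e * deriv S t)"
      using i2 by simp
    show "\<bar>(u t - c) * deriv S t\<bar> \<le> e * deriv S t" for t
      using close[of t] zero[of t] nonneg[of t]
      by (cases "t \<in> {a..b}") (auto simp: abs_mult intro: mult_right_mono)
  qed
  then show ?thesis using eq one by simp
qed

text \<open>The weights concentrate at \<open>x\<close>, and \<open>u\<close> is continuous there
  relative to the unit interval.\<close>

lemma step_average_tendsto:
  fixes u :: "real \<Rightarrow> real" and S :: "nat \<Rightarrow> real \<Rightarrow> real"
  assumes u: "continuous_on {0..1} u" and S: "\<And>n. smooth (S n)" "\<And>n. mono (S n)"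
    and ab: "\<And>n. 0 \<le> a n" "\<And>n. b n \<le> 1"
      "\<And>n t. t \<le> a n \<Longrightarrow> S n t = 0" "\<And>n t. t \<ge> b n \<Longrightarrow> S n t = 1"
    and lim: "a \<longlonglongrightarrow> x" "b \<longlonglongrightarrow> x" and x: "x \<in> {0..1}"
  shows "(\<lambda>n. LINT t|lebesgue_on {0<..<1}. u t * deriv (S n) t) \<longlonglongrightarrow> u x"
proof (rule LIMSEQ_I)
  fix e :: real assume "e > 0"
  then obtain d where d: "d > 0" "\<And>t. t \<in> {0..1} \<Longrightarrow> dist t x < d \<Longrightarrow> dist (u t) (u x) < e / 2"
    using u x unfolding continuous_on_iff by (metis half_gt_zero)
  have "eventually (\<lambda>n. dist (a n) x < d) sequentially" "eventually (\<lambda>n. dist (b n) x < d) sequentially"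
    using lim d(1) by (auto dest: tendstoD)
  then have "eventually (\<lambda>n. norm ((LINT t|lebesgue_on {0<..<1}. u t * deriv (S n) t) - u x) < e) sequentially"
  proof eventually_elim
    case (elim n)
    have "\<bar>(LINT t|lebesgue_on {0<..<1}. u t * deriv (S n) t) - u x\<bar> \<le> e / 2"
    proof (rule step_average[OF u S, of "a n" "b n"])
      fix t assume t: "t \<in> {a n..b n}"
      then have "dist t x < d" using elim by (auto simp: dist_real_def)
      with t show "\<bar>u t - u x\<bar> \<le> e / 2"
        using d(2)[of t] ab(1)[of n] ab(2)[of n] by (auto simp: dist_real_def)
    qed (use ab in auto)
    then show ?case using \<open>e > 0\<close> by simp
  qed
  then show "\<exists>no. \<forall>n\<ge>no. norm ((LINT t|lebesgue_on {0<..<1}. u t * deriv (S n) t) - u x) < e"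
    by (simp add: eventually_sequentially)
qed

lemma has_weak_deriv_set_integrable:
  assumes "has_weak_deriv u g" "0 < a" "b < 1"
  shows "set_integrable lebesgue {a..b} g"
proof -
  have "{a..b} \<subseteq> {0<..<1}" using assms by auto
  then show ?thesis using assms by (auto simp: has_weak_deriv_def locally_integrable_def)
qed

text \<open>Testing the weak derivative against the difference of two smooth steps, one rising just to
  the right of \<open>x\<close> and the other one just to the left of \<open>y\<close>, gives the fundamental theorem of
  calculus in the limit.\<close>

lemma weak_deriv_increment:
  fixes u g :: "real \<Rightarrow> real"
  assumes w: "has_weak_deriv u g" and u: "continuous_on {0..1} u" and xy: "0 < x" "x < y" "y < 1"
  shows "u y - u x = (LINT t:{x<..<y}|lebesgue. g t)"
proof -
  let ?M = "lebesgue_on {0<..<1::real}"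
  \<comment> \<open>The denominator \<open>n + 2\<close> keeps \<open>h n\<close> strictly below
    \<open>y - x\<close> from \<open>n = 0\<close> on.\<close>
  define h where "h n = (y - x) / (real n + 2)" for n
  have h: "0 < h n" "h n < y - x" for n
    unfolding h_def using xy by (auto simp: divide_less_eq)
  have h0: "h \<longlonglongrightarrow> 0"
    unfolding h_def by real_asymp
  have "\<exists>S. smooth S \<and> (\<forall>t\<le>x. S t = 0) \<and> (\<forall>t\<ge>x + h n. S t = 1) \<and> mono S" for n
    by (rule smooth_step_exists[of x "x + h n"]) (use h[of n] in auto)
  then obtain S where S: "\<And>n. smooth (S n)" "\<And>n t. t \<le> x \<Longrightarrow> S n t = 0"
      "\<And>n t. t \<ge> x + h n \<Longrightarrow> S n t = 1" "\<And>n. mono (S n)"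
    by metis
  have "\<exists>T. smooth T \<and> (\<forall>t\<le>y - h n. T t = 0) \<and> (\<forall>t\<ge>y. T t = 1) \<and> mono T" for n
    by (rule smooth_step_exists[of "y - h n" y]) (use h[of n] in auto)
  then obtain T where T: "\<And>n. smooth (T n)" "\<And>n t. t \<le> y - h n \<Longrightarrow> T n t = 0"
      "\<And>n t. t \<ge> y \<Longrightarrow> T n t = 1" "\<And>n. mono (T n)"
    by metis
  \<comment> \<open>Compare \<open>t\<close> with a point of the lower plateau and a point of the
    upper plateau by monotonicity.\<close>
  have bd: "0 \<le> S n t" "S n t \<le> 1" "0 \<le> T n t" "T n t \<le> 1" for n t
    using S(2)[of "min t x" n] S(3)[of n "max t (x + h n)"] monoD[OF S(4)[of n], of "min t x" t]
      monoD[OF S(4)[of n], of t "max t (x + h n)"]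
      T(2)[of "min t (y - h n)" n] T(3)[of "max t y" n] monoD[OF T(4)[of n], of "min t (y - h n)" t]
      monoD[OF T(4)[of n], of t "max t y"]
    by auto
  \<comment> \<open>Both steps vanish to the left of \<open>x\<close> and equal 1 to the right of
    \<open>y\<close>, so the difference is supported in \<open>[x, y]\<close>.\<close>
  define \<phi> where "\<phi> n t = S n t - T n t" for n t
  have sm: "smooth (\<phi> n)" for n
    unfolding \<phi>_def by (intro smooth_diff S T)
  have supp: "\<phi> n t = 0" if "t \<notin> {x..y}" for n t
    using that S(2)[of t n] S(3)[of n t] T(2)[of t n] T(3)[of t n] h[of n]
    by (cases "t < x") (auto simp: \<phi>_def)
  have test: "test_function (\<phi> n)" for n
  proof -
    have sub: "closure {t. \<phi> n t \<noteq> 0} \<subseteq> {x..y}"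
      by (rule closure_minimal) (use supp in blast, simp)
    then have "compact (closure {t. \<phi> n t \<noteq> 0})"
      by (metis bounded_closed_interval bounded_subset closed_closure compact_eq_bounded_closed)
    then show ?thesis
      using sm sub xy by (auto simp: test_function_def smooth_def)
  qed
  have d: "deriv (\<phi> n) t = deriv (S n) t - deriv (T n) t" for n t
    unfolding \<phi>_def
    by (intro DERIV_imp_deriv DERIV_diff smooth_has_deriv S T)
  have "(\<lambda>n. (LINT t|?M. u t * deriv (S n) t) - (LINT t|?M. u t * deriv (T n) t)) \<longlonglongrightarrow> u x - u y"
  proof (rule tendsto_diff)
    show "(\<lambda>n. LINT t|?M. u t * deriv (S n) t) \<longlonglongrightarrow> u x"
    proof (rule step_average_tendsto[OF u S(1,4), of "\<lambda>_. x" "\<lambda>n. x + h n"])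
      show "(\<lambda>n. x + h n) \<longlonglongrightarrow> x" using tendsto_add[OF tendsto_const h0] by simp
    next
      show "x + h n \<le> 1" for n using h[of n] xy by simp
    qed (use S xy in auto)
    show "(\<lambda>n. LINT t|?M. u t * deriv (T n) t) \<longlonglongrightarrow> u y"
    proof (rule step_average_tendsto[OF u T(1,4), of "\<lambda>n. y - h n" "\<lambda>_. y"])
      show "(\<lambda>n. y - h n) \<longlonglongrightarrow> y" using tendsto_diff[OF tendsto_const h0] by simp
    next
      show "0 \<le> y - h n" for n using h[of n] xy by simp
    qed (use T xy in auto)
  qed
  also have "(\<lambda>n. (LINT t|?M. u t * deriv (S n) t) - (LINT t|?M. u t * deriv (T n) t))
    = (\<lambda>n. LINT t|?M. u t * deriv (\<phi> n) t)"
  proof (rule ext)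
    fix n
    have "integrable ?M (\<lambda>t. u t * deriv (S n) t)" "integrable ?M (\<lambda>t. u t * deriv (T n) t)"
      by (intro integrable_continuous_unit_interval continuous_intros u smooth_continuous_on smooth_deriv S T)+
    then show "(LINT t|?M. u t * deriv (S n) t) - (LINT t|?M. u t * deriv (T n) t)
        = (LINT t|?M. u t * deriv (\<phi> n) t)"
      by (subst Bochner_Integration.integral_diff[symmetric]) (auto simp: d right_diff_distrib)
  qed
  also have "\<dots> = (\<lambda>n. - (LINT t|?M. g t * \<phi> n t))"
    using w test by (simp add: has_weak_deriv_def)
  finally have lim1: "(\<lambda>n. - (LINT t|?M. g t * \<phi> n t)) \<longlonglongrightarrow> u x - u y" .
  \<comment> \<open>Only local integrability of \<open>g\<close> is available; cutting off to
    \<open>[x, y]\<close> gives an integrable function on the whole line without changing the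
    products with \<open>\<phi> n\<close>.\<close>
  define G where "G t = indicator {x..y} t * g t" for t
  have iG: "integrable lebesgue G"
  proof -
    have "set_integrable lebesgue {x..y} g"
      using w xy by (intro has_weak_deriv_set_integrable)
    then show ?thesis by (simp add: set_integrable_def G_def[abs_def])
  qed
  have eq: "(LINT t|?M. g t * \<phi> n t) = (LINT t|lebesgue. G t * \<phi> n t)" for n
    unfolding LINT_unit_interval set_lebesgue_integral_def
    by (rule Bochner_Integration.integral_cong)
      (use xy supp[of _ n] in \<open>auto simp: G_def indicator_def\<close>)
  have "(\<lambda>n. LINT t|lebesgue. G t * \<phi> n t) \<longlonglongrightarrow> (LINT t|lebesgue. G t * indicator {x<..<y} t)"
  proof (rule integral_dominated_convergence[where w = "\<lambda>t. \<bar>G t\<bar>"])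
    show "(\<lambda>t. G t * indicator {x<..<y} t) \<in> borel_measurable lebesgue"
      by (intro borel_measurable_times borel_measurable_integrable[OF iG] borel_measurable_indicator) simp
    show "(\<lambda>t. G t * \<phi> n t) \<in> borel_measurable lebesgue" for n
    proof -
      have "\<phi> n \<in> borel_measurable borel"
        by (rule borel_measurable_continuous_onI[OF smooth_continuous_on[OF sm]])
      then have "\<phi> n \<in> borel_measurable lebesgue"
        by (simp add: measurable_completion)
      then show ?thesis using borel_measurable_integrable[OF iG] by measurable
    qed
    show "integrable lebesgue (\<lambda>t. \<bar>G t\<bar>)" using iG by simp
    show "AE t in lebesgue. norm (G t * \<phi> n t) \<le> \<bar>G t\<bar>" for n
    proof (rule AE_I2)
      fix t
      have "\<bar>\<phi> n t\<bar> \<le> 1" using bd[of n t] by (auto simp: \<phi>_def)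
      then show "norm (G t * \<phi> n t) \<le> \<bar>G t\<bar>"
        by (simp add: abs_mult mult_left_le)
    qed
    show "AE t in lebesgue. (\<lambda>n. G t * \<phi> n t) \<longlonglongrightarrow> G t * indicator {x<..<y} t"
    proof (rule AE_I2)
      fix t
      \<comment> \<open>For each fixed \<open>t\<close> the sequence is eventually constant: an
        interior point finally lies on the upper plateau of \<open>S n\<close> and the lower plateau
        of \<open>T n\<close>, while elsewhere the two steps agree.\<close>
      have "eventually (\<lambda>n. \<phi> n t = indicator {x<..<y} t) sequentially"
      proof (cases "t \<in> {x<..<y}")
        case True
        then have "eventually (\<lambda>n. h n < t - x) sequentially" "eventually (\<lambda>n. h n < y - t) sequentially"
          using order_tendstoD(2)[OF h0] by auto
        then show ?thesis
        proof eventually_elim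
          case (elim n)
          then show ?case using True S(3)[of n t] T(2)[of t n] by (simp add: \<phi>_def)
        qed
      next
        case False
        have "\<phi> n t = 0" for n
        proof (cases "t \<le> x")
          case True
          then show ?thesis using S(2)[of t n] T(2)[of t n] h[of n] by (simp add: \<phi>_def)
        next
          case f: False
          then show ?thesis using False S(3)[of n t] T(3)[of t n] h[of n] by (simp add: \<phi>_def)
        qed
        then show ?thesis using False by simp
      qed
      then have "(\<lambda>n. \<phi> n t) \<longlonglongrightarrow> indicator {x<..<y} t" by (rule tendsto_eventually)
      then show "(\<lambda>n. G t * \<phi> n t) \<longlonglongrightarrow> G t * indicator {x<..<y} t"
        by (rule tendsto_mult_left)
    qed
  qed
  also have "(LINT t|lebesgue. G t * indicator {x<..<y} t) = (LINT t:{x<..<y}|lebesgue. g t)"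
    unfolding set_lebesgue_integral_def
    by (rule Bochner_Integration.integral_cong) (auto simp: G_def indicator_def)
  finally have "(\<lambda>n. - (LINT t|?M. g t * \<phi> n t)) \<longlonglongrightarrow> - (LINT t:{x<..<y}|lebesgue. g t)"
    by (subst eq) (rule tendsto_minus)
  from LIMSEQ_unique[OF lim1 this] show ?thesis by simp
qed

section \<open>Almost everywhere uniqueness of the weak derivative\<close>

text \<open>Open intervals form an intersection-stable generator of the Borel sets, and the sets on
  which \<open>f\<close> integrates to zero are closed under complements and countable disjoint
  unions. Lebesgue sets differ from Borel sets by null sets only, and a function with zero integral
  over all of them vanishes almost everywhere.\<close>

lemma integral_intervals_eq_0_imp_AE_0:
  fixes f :: "real \<Rightarrow> real"
  assumes f: "integrable lebesgue f" and zero: "\<And>a b. (LINT t:{a<..<b}|lebesgue. f t) = 0"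
  shows "AE t in lebesgue. f t = 0"
proof (rule density_unique_real[OF f integrable_zero])
  have si: "set_integrable lebesgue A f" if "A \<in> sets lebesgue" for A
    unfolding set_integrable_def using integrable_mult_indicator[OF that f] .
  \<comment> \<open>Exhausting the line by bounded intervals gives the integral over everything,
    which the complement case of the induction needs.\<close>
  have total: "integral\<^sup>L lebesgue f = 0"
  proof -
    have "(\<lambda>n. LINT t:{- real n<..<real n}|lebesgue. f t) \<longlonglongrightarrow> integral\<^sup>L lebesgue f"
      unfolding set_lebesgue_integral_def
    proof (rule integral_dominated_convergence[where w = "\<lambda>t. \<bar>f t\<bar>"])
      show "AE t in lebesgue. (\<lambda>n. indicat_real {- real n<..<real n} t *\<^sub>R f t) \<longlonglongrightarrow> f t"
      proof (rule AE_I2)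
        fix t
        obtain k where k: "\<bar>t\<bar> < real k" using reals_Archimedean2 by blast
        show "(\<lambda>n. indicat_real {- real n<..<real n} t *\<^sub>R f t) \<longlonglongrightarrow> f t"
        proof (rule tendsto_eventually, rule eventually_sequentiallyI)
          fix n assume "k \<le> n"
          then have "t \<in> {- real n<..<real n}" using k by auto
          then show "indicat_real {- real n<..<real n} t *\<^sub>R f t = f t" by simp
        qed
      qed
      show "(\<lambda>t. indicat_real {- real n<..<real n} t *\<^sub>R f t) \<in> borel_measurable lebesgue" for n
        by (intro borel_measurable_scaleR borel_measurable_indicator borel_measurable_integrable[OF f]) simp
    qed (use f in \<open>auto simp: indicator_def\<close>)
    then show ?thesis using zero by (simp add: LIMSEQ_const_iff)
  qed
  have borel: "(LINT t:A|lebesgue. f t) = 0" if "A \<in> sets borel" for A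
  proof -
    let ?G = "range (\<lambda>(a, b). box a b :: real set)"
    have G: "sets borel = sigma_sets UNIV ?G"
      by (subst borel_eq_box) simp
    have "Int_stable ?G"
    proof (rule Int_stableI)
      fix A B assume "A \<in> ?G" "B \<in> ?G"
      then obtain a b c d where AB: "A = {a<..<b}" "B = {c<..<d}" by auto
      have "A \<inter> B = {max a c<..<min b d}" unfolding AB by auto
      then show "A \<inter> B \<in> ?G" by (auto intro!: image_eqI[of _ _ "(max a c, min b d)"])
    qed
    moreover have "?G \<subseteq> Pow UNIV" by simp
    moreover have "A \<in> sigma_sets UNIV ?G"
      using that G by simp
    ultimately show ?thesis
    proof (induction rule: sigma_sets_induct_disjoint)
      case (basic A)
      then show ?case using zero by auto
    next
      case empty
      then show ?case by (simp add: set_lebesgue_integral_def)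
    next
      case (compl A)
      then have A: "A \<in> sets lebesgue"
        using G by simp
      then have "UNIV - A \<in> sets lebesgue"
        by (metis Compl_eq_Diff_UNIV Compl_in_sets_lebesgue)
      then have "(LINT t:UNIV - A|lebesgue. f t) + (LINT t:A|lebesgue. f t) = (LINT t:UNIV|lebesgue. f t)"
        by (subst set_integral_Un[symmetric]) (use A si in \<open>auto simp: Un_commute\<close>)
      then show ?case using compl total by (simp add: set_lebesgue_integral_def)
    next
      case (union A)
      have A: "A i \<in> sets lebesgue" for i
      proof -
        have "A i \<in> sets borel"
          using union(2) G by auto
        then show ?thesis by simp
      qed
      have "(LINT t:(\<Union>i. A i)|lebesgue. f t) = (\<Sum>i. LINT t:A i|lebesgue. f t)"
        by (rule lebesgue_integral_countable_add)
          (use union A si in \<open>auto simp: disjoint_family_on_def\<close>)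
      then show ?case using union by simp
    qed
  qed
  \<comment> \<open>A Lebesgue set is a Borel set \<open>S\<close> up to a subset of a Borel null
    set \<open>N'\<close>, so the Borel case carries over.\<close>
  fix A :: "real set" assume "A \<in> sets lebesgue"
  then obtain S N N' where A: "A = S \<union> N" "N \<subseteq> N'" "N' \<in> null_sets lborel" "S \<in> sets lborel"
    by (rule sets_completionE)
  have "AE t in lebesgue. t \<notin> N'"
    using A(3) by (intro AE_not_in null_sets_completionI)
  then have ae: "AE t in lebesgue. indicat_real A t *\<^sub>R f t = indicat_real S t *\<^sub>R f t"
    by eventually_elim (use A in \<open>auto simp: indicator_def\<close>)
  have "(LINT t:A|lebesgue. f t) = (LINT t:S|lebesgue. f t)"
    unfolding set_lebesgue_integral_def
    by (rule integral_cong_AE[OF _ _ ae]; intro borel_measurable_scaleR borel_measurable_indicator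
        borel_measurable_integrable[OF f])
      (use A \<open>A \<in> sets lebesgue\<close> in auto)
  then show "(LINT t:A|lebesgue. f t) = (LINT t:A|lebesgue. 0)" using borel[of S] A by simp
qed

text \<open>By \<open>weak_deriv_increment\<close> the integrals of \<open>g\<close> and
  \<open>g'\<close> over an interval both equal the increment of \<open>u\<close>. Since the two
  functions are only locally integrable, the comparison is made on intervals \<open>K n\<close> that
  stay away from 0 and 1 and exhaust the unit interval.\<close>

lemma has_weak_deriv_unique:
  assumes w: "has_weak_deriv u g" "has_weak_deriv u g'" and u: "continuous_on {0..1} u"
  shows "AE t in lebesgue_on {0<..<1}. g t = g' t"
proof -
  define K where "K n = {1 / (real n + 3)<..<1 - 1 / (real n + 3)}" for n
  have "AE t in lebesgue. t \<in> K n \<longrightarrow> g t = g' t" for n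
  proof -
    let ?c = "1 / (real n + 3)"
    define f where "f t = indicator (K n) t * (g t - g' t)" for t
    have c: "0 < ?c" "?c < 1" by (auto simp: divide_less_eq)
    have si: "set_integrable lebesgue {?c<..<1 - ?c} w" if "has_weak_deriv u w" for w
      by (rule set_integrable_subset[OF has_weak_deriv_set_integrable[OF that, of ?c "1 - ?c"]]) (use c in auto)
    have int: "integrable lebesgue f"
      using set_integral_diff(1)[OF si[OF w(1)] si[OF w(2)]]
      by (simp add: set_integrable_def f_def[abs_def] K_def)
    have "AE t in lebesgue. f t = 0"
    proof (rule integral_intervals_eq_0_imp_AE_0[OF int])
      fix a b
      \<comment> \<open>Clipping an arbitrary interval to \<open>K n\<close> keeps its ends strictly
        between 0 and 1 whenever it is nonempty.\<close>
      define x y where "x = max a ?c" and "y = min b (1 - ?c)"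
      have "(LINT t:{a<..<b}|lebesgue. f t) = (LINT t:{x<..<y}|lebesgue. g t - g' t)"
        unfolding set_lebesgue_integral_def
        by (rule Bochner_Integration.integral_cong)
          (auto simp: f_def x_def y_def K_def indicator_def)
      also have "\<dots> = 0"
      proof (cases "x < y")
        case True
        have xy: "0 < x" "y < 1" using c by (simp_all add: x_def y_def less_max_iff_disj min_less_iff_disj)
        have sub: "set_integrable lebesgue {x<..<y} w" if "has_weak_deriv u w" for w
          by (rule set_integrable_subset[OF si[OF that]]) (auto simp: x_def y_def)
        have "(LINT t:{x<..<y}|lebesgue. g t - g' t) =
            (LINT t:{x<..<y}|lebesgue. g t) - (LINT t:{x<..<y}|lebesgue. g' t)"
          by (intro set_integral_diff(2) sub w)
        then show ?thesis
          using weak_deriv_increment[OF w(1) u xy(1) True xy(2)]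
            weak_deriv_increment[OF w(2) u xy(1) True xy(2)] by simp
      qed (simp add: set_lebesgue_integral_def)
      finally show "(LINT t:{a<..<b}|lebesgue. f t) = 0" .
    qed
    then show ?thesis by eventually_elim (auto simp: f_def)
  qed
  then have "AE t in lebesgue. \<forall>n. t \<in> K n \<longrightarrow> g t = g' t"
    by (subst AE_all_countable) blast
  then have "AE t in lebesgue. t \<in> {0<..<1} \<longrightarrow> g t = g' t"
  proof eventually_elim
    case (elim t)
    show ?case
    proof
      assume t: "t \<in> {0<..<1}"
      have "(\<lambda>n. 1 / (real n + 3)) \<longlonglongrightarrow> 0" by real_asymp
      then have "eventually (\<lambda>n. 1 / (real n + 3) < min t (1 - t)) sequentially"
        by (rule order_tendstoD) (use t in auto)
      then obtain n where "1 / (real n + 3) < min t (1 - t)"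
        by (auto simp: eventually_sequentially)
      then have "t \<in> K n" by (auto simp: K_def)
      then show "g t = g' t" using elim by blast
    qed
  qed
  then show ?thesis by (simp add: AE_restrict_space_iff)
qed

section \<open>Hoelder estimates in the Sobolev space\<close>

text \<open>The majorant is \<open>1 + \<bar>f x\<bar> ^ p\<close>, and constants are integrable for
  a finite measure.\<close>

lemma (in finite_measure) integrable_abs_power_mono:
  fixes f :: "'a \<Rightarrow> real"
  assumes f: "f \<in> borel_measurable M" "integrable M (\<lambda>x. \<bar>f x\<bar> ^ p)" and p: "p \<ge> 1"
  shows "integrable M f"
proof (rule Bochner_Integration.integrable_bound)
  show "integrable M (\<lambda>x. 1 + \<bar>f x\<bar> ^ p)"
    using f by simp
  show "AE x in M. norm (f x) \<le> norm (1 + \<bar>f x\<bar> ^ p)"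
  proof (rule AE_I2)
    fix x
    have "\<bar>f x\<bar> \<le> 1 + \<bar>f x\<bar> ^ p"
    proof (cases "\<bar>f x\<bar> \<le> 1")
      case False
      then have "\<bar>f x\<bar> ^ 1 \<le> \<bar>f x\<bar> ^ p" by (intro power_increasing p) auto
      then show ?thesis by simp
    qed (simp add: add_increasing2)
    then show "norm (f x) \<le> norm (1 + \<bar>f x\<bar> ^ p)" by simp
  qed
qed (use f in simp)

text \<open>The graph of \<open>t \<mapsto> t\<^sup>p\<close> lies above its tangent at the mean value of \<open>\<bar>f\<bar>\<close>.\<close>

lemma (in finite_measure) abs_integral_power_le:
  fixes f :: "'a \<Rightarrow> real"
  assumes f: "f \<in> borel_measurable M" "integrable M (\<lambda>x. \<bar>f x\<bar> ^ p)" and p: "p \<ge> 1"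
    and pos: "measure M (space M) > 0"
  shows "\<bar>integral\<^sup>L M f\<bar> ^ p \<le> measure M (space M) ^ (p - 1) * (\<integral>x. \<bar>f x\<bar> ^ p \<partial>M)"
proof -
  let ?\<mu> = "measure M (space M)"
  have fi: "integrable M (\<lambda>x. \<bar>f x\<bar>)"
    using integrable_abs_power_mono[OF f p] by simp
  define m where "m = (\<integral>x. \<bar>f x\<bar> \<partial>M) / ?\<mu>"
  have "?\<mu> * m ^ p \<le> (\<integral>x. \<bar>f x\<bar> ^ p \<partial>M)"
  proof (cases "m > 0")
    case True
    \<comment> \<open>Bernoulli's inequality at \<open>\<bar>t\<bar> / m - 1\<close>, scaled by
      \<open>m ^ p\<close>.\<close>
    have tangent: "m ^ p + real p * m ^ (p - 1) * (\<bar>t\<bar> - m) \<le> \<bar>t\<bar> ^ p" for t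
    proof -
      have "m ^ p * (1 + real p * (\<bar>t\<bar> / m - 1)) \<le> m ^ p * (1 + (\<bar>t\<bar> / m - 1)) ^ p"
        by (intro mult_left_mono Bernoulli_inequality) (use True in auto)
      also have "\<dots> = \<bar>t\<bar> ^ p"
        using True by (simp add: power_divide)
      also have "m ^ p * (1 + real p * (\<bar>t\<bar> / m - 1)) = m ^ p + real p * m ^ (p - 1) * (\<bar>t\<bar> - m)"
        using True p by (cases p) (simp_all add: field_simps)
      finally show ?thesis .
    qed
    have "?\<mu> * m ^ p = (\<integral>x. m ^ p + real p * m ^ (p - 1) * (\<bar>f x\<bar> - m) \<partial>M)"
      using fi pos by (simp add: m_def)
    also have "\<dots> \<le> (\<integral>x. \<bar>f x\<bar> ^ p \<partial>M)"
      by (intro integral_mono tangent) (use fi f in auto)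
    finally show ?thesis .
  next
    case False
    then have "m = 0" using pos by (simp add: m_def not_less order_antisym zero_le_divide_iff divide_le_0_iff)
    then show ?thesis using p by (simp add: power_0_left)
  qed
  \<comment> \<open>This factor turns the left side into the \<open>p\<close>-th power of the
    integral of \<open>\<bar>f\<bar>\<close>, because \<open>?\<mu> * m\<close> is that
    integral.\<close>
  then have "?\<mu> ^ (p - 1) * (?\<mu> * m ^ p) \<le> ?\<mu> ^ (p - 1) * (\<integral>x. \<bar>f x\<bar> ^ p \<partial>M)"
    by (rule mult_left_mono) simp
  moreover have "?\<mu> ^ (p - 1) * (?\<mu> * m ^ p) = (\<integral>x. \<bar>f x\<bar> \<partial>M) ^ p"
    using pos p by (cases p) (simp_all add: m_def power_divide)
  moreover have "\<bar>integral\<^sup>L M f\<bar> ^ p \<le> (\<integral>x. \<bar>f x\<bar> \<partial>M) ^ p"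
    by (intro power_mono integral_abs_bound) simp
  ultimately show ?thesis by simp
qed

section \<open>Independence of the chosen version of the weak derivative\<close>

lemma Lp_space_imp_integrable:
  assumes "f \<in> Lp_space p" "p \<ge> 1"
  shows "integrable (lebesgue_on {0<..<1}) f"
proof (rule finite_measure.integrable_abs_power_mono[OF finite_measure_unit_interval _ _ assms(2)])
  show "f \<in> borel_measurable (lebesgue_on {0<..<1})"
    "integrable (lebesgue_on {0<..<1}) (\<lambda>x. \<bar>f x\<bar> ^ p)"
    using assms(1) unfolding Lp_space_def by blast+
qed

text \<open>Lebesgue measure is complete: extend both functions by zero to the line, where almost
  everywhere equality preserves measurability.\<close>

lemma measurable_unit_interval_AE:
  fixes f g :: "real \<Rightarrow> real"
  assumes f: "f \<in> borel_measurable (lebesgue_on {0<..<1})"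
    and eq: "AE t in lebesgue_on {0<..<1}. f t = g t"
  shows "g \<in> borel_measurable (lebesgue_on {0<..<1})"
proof -
  have "(\<lambda>t. if t \<in> {0<..<1} then f t else 0) \<in> borel_measurable lebesgue"
    using f borel_measurable_if[of "{0<..<1}" f] by simp
  moreover have "AE t in lebesgue. (if t \<in> {0<..<1} then f t else 0) = (if t \<in> {0<..<1} then g t else 0)"
    using eq by (subst (asm) AE_restrict_space_iff) auto
  ultimately have "(\<lambda>t. if t \<in> {0<..<1} then g t else 0) \<in> borel_measurable lebesgue"
    by (rule borel_measurable_AE)
  then show ?thesis
    using borel_measurable_if[of "{0<..<1}" g] by simp
qed

text \<open>Makes the choice inside \<open>weak_deriv\<close> harmless: the chosen function agrees
  almost everywhere with any explicit weak derivative.\<close>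

lemma weak_deriv_AE:
  assumes g: "has_weak_deriv u g" and u: "continuous_on {0..1} u"
  shows "has_weak_deriv u (weak_deriv u)" "AE t in lebesgue_on {0<..<1}. g t = weak_deriv u t"
proof -
  show *: "has_weak_deriv u (weak_deriv u)"
    unfolding weak_deriv_def using g by (rule someI[of "has_weak_deriv u"])
  show "AE t in lebesgue_on {0<..<1}. g t = weak_deriv u t"
    using has_weak_deriv_unique[OF g * u] .
qed

text \<open>Allows the energy to be computed from an explicit weak derivative, as is done for the
  Moser functions.\<close>

lemma weak_deriv_Lp_space:
  assumes g: "has_weak_deriv u g" "g \<in> Lp_space p" and u: "continuous_on {0..1} u"
  shows "weak_deriv u \<in> Lp_space p"
    "(LINT t|lebesgue_on {0<..<1}. \<bar>weak_deriv u t\<bar> ^ p) = (LINT t|lebesgue_on {0<..<1}. \<bar>g t\<bar> ^ p)"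
proof -
  note ae = weak_deriv_AE(2)[OF g(1) u]
  have gm: "g \<in> borel_measurable (lebesgue_on {0<..<1})"
    using g by (simp add: Lp_space_def)
  have wm: "weak_deriv u \<in> borel_measurable (lebesgue_on {0<..<1})"
    by (rule measurable_unit_interval_AE[OF gm ae])
  have ae': "AE t in lebesgue_on {0<..<1}. \<bar>weak_deriv u t\<bar> ^ p = \<bar>g t\<bar> ^ p"
    using ae by eventually_elim simp
  show "(LINT t|lebesgue_on {0<..<1}. \<bar>weak_deriv u t\<bar> ^ p) = (LINT t|lebesgue_on {0<..<1}. \<bar>g t\<bar> ^ p)"
    by (rule integral_cong_AE) (use gm wm ae' in auto)
  have "integrable (lebesgue_on {0<..<1}) (\<lambda>t. \<bar>weak_deriv u t\<bar> ^ p) =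
        integrable (lebesgue_on {0<..<1}) (\<lambda>t. \<bar>g t\<bar> ^ p)"
    by (rule integrable_cong_AE) (use gm wm ae' in auto)
  then show "weak_deriv u \<in> Lp_space p"
    using g wm by (simp add: Lp_space_def)
qed

lemma sobolev_weak_deriv:
  assumes "u \<in> sobolev p"
  shows "continuous_on {0..1} u" "has_weak_deriv u (weak_deriv u)" "weak_deriv u \<in> Lp_space p"
    "u \<in> Lp_space p"
proof -
  obtain g where u: "continuous_on {0..1} u" "u \<in> Lp_space p" and g: "has_weak_deriv u g" "g \<in> Lp_space p"
    using assms unfolding sobolev_def by blast
  show "continuous_on {0..1} u" "u \<in> Lp_space p" by (rule u)+
  show "has_weak_deriv u (weak_deriv u)" by (rule weak_deriv_AE(1)[OF g(1) u(1)])
  show "weak_deriv u \<in> Lp_space p" by (rule weak_deriv_Lp_space(1)[OF g u(1)])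
qed

text \<open>Admits the left end \<open>x = 0\<close>, where the functions of \<open>E_space\<close>
  vanish. Let the left end decrease to \<open>x\<close>: \<open>u\<close> is continuous there, and
  the weak derivative, being in \<open>Lp_space p\<close>, is integrable up to 0 and dominates the
  integrals.\<close>

lemma sobolev_increment:
  assumes u: "u \<in> sobolev p" and p: "p \<ge> 1" and xy: "0 \<le> x" "x < y" "y < 1"
  shows "u y - u x = (LINT t:{x<..<y}|lebesgue. weak_deriv u t)"
proof -
  let ?g = "weak_deriv u"
  have gi: "set_integrable lebesgue {0<..<1} ?g"
    using Lp_space_imp_integrable[OF sobolev_weak_deriv(3)[OF u] p] by (simp add: integrable_unit_interval_iff)
  have gi': "set_integrable lebesgue {x<..<y} ?g"
    by (rule set_integrable_subset[OF gi]) (use xy in auto)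
  \<comment> \<open>These points lie strictly between \<open>x\<close> and \<open>y\<close>, hence
    are positive even if \<open>x = 0\<close>.\<close>
  define a where "a n = x + (y - x) / (real n + 2)" for n
  have a: "0 < a n" "x < a n" "a n < y" for n
    using xy divide_strict_left_mono[of 1 "real n + 2" "y - x"]
    by (auto simp: a_def add_nonneg_pos)
  have lim: "a \<longlonglongrightarrow> x"
    unfolding a_def by real_asymp
  have "(\<lambda>n. u (a n)) \<longlonglongrightarrow> u x"
    by (rule continuous_on_tendsto_compose[OF sobolev_weak_deriv(1)[OF u] lim])
      (use xy a in \<open>auto intro!: always_eventually less_imp_le intro: less_trans\<close>)
  then have 1: "(\<lambda>n. u y - u (a n)) \<longlonglongrightarrow> u y - u x"
    by (intro tendsto_diff tendsto_const)
  have "(\<lambda>n. LINT t:{a n<..<y}|lebesgue. ?g t) \<longlonglongrightarrow> (LINT t:{x<..<y}|lebesgue. ?g t)"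
    unfolding set_lebesgue_integral_def
  proof (rule integral_dominated_convergence[where w = "\<lambda>t. \<bar>indicator {x<..<y} t *\<^sub>R ?g t\<bar>"])
    show "(\<lambda>t. indicat_real {x<..<y} t *\<^sub>R ?g t) \<in> borel_measurable lebesgue"
      using borel_measurable_integrable[OF gi'[unfolded set_integrable_def]] .
    show "(\<lambda>t. indicat_real {a n<..<y} t *\<^sub>R ?g t) \<in> borel_measurable lebesgue" for n
    proof -
      have "set_integrable lebesgue {a n<..<y} ?g"
        by (rule set_integrable_subset[OF gi']) (use a(2)[of n] in auto)
      then show ?thesis unfolding set_integrable_def by (rule borel_measurable_integrable)
    qed
    show "integrable lebesgue (\<lambda>t. \<bar>indicator {x<..<y} t *\<^sub>R ?g t\<bar>)"
      using gi'[unfolded set_integrable_def] by (rule integrable_abs)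
    show "AE t in lebesgue. norm (indicat_real {a n<..<y} t *\<^sub>R ?g t) \<le> \<bar>indicator {x<..<y} t *\<^sub>R ?g t\<bar>" for n
      by (rule AE_I2) (use a(2)[of n] in \<open>auto simp: indicator_def\<close>)
    show "AE t in lebesgue. (\<lambda>n. indicat_real {a n<..<y} t *\<^sub>R ?g t) \<longlonglongrightarrow> indicat_real {x<..<y} t *\<^sub>R ?g t"
    proof (rule AE_I2, rule tendsto_eventually)
      fix t
      show "eventually (\<lambda>n. indicat_real {a n<..<y} t *\<^sub>R ?g t = indicat_real {x<..<y} t *\<^sub>R ?g t) sequentially"
      proof (cases "x < t")
        case True
        have "eventually (\<lambda>n. a n < t) sequentially" using order_tendstoD(2)[OF lim True] .
        then show ?thesis by eventually_elim (use True in \<open>auto simp: indicator_def\<close>)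
      next
        case False
        have "\<not> a n < t" for n using a(2)[of n] False by simp
        then show ?thesis using False by (auto simp: indicator_def)
      qed
    qed
  qed
  then have 2: "(\<lambda>n. u y - u (a n)) \<longlonglongrightarrow> (LINT t:{x<..<y}|lebesgue. ?g t)"
    using weak_deriv_increment[OF sobolev_weak_deriv(2,1)[OF u] a(1) a(3) xy(3)] by simp
  show ?thesis by (rule LIMSEQ_unique[OF 1 2])
qed

text \<open>Hoelder's inequality in the form of \<open>abs_integral_power_le\<close>, on an interval
  of measure \<open>y - x\<close>, applied to the increment formula.\<close>

lemma sobolev_holder:
  assumes u: "u \<in> sobolev p" and p: "p \<ge> 1" and xy: "0 \<le> x" "x < y" "y < 1"
  shows "\<bar>u y - u x\<bar> ^ p \<le> (y - x) ^ (p - 1) * (LINT t:{x<..<y}|lebesgue. \<bar>weak_deriv u t\<bar> ^ p)"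
proof -
  let ?g = "weak_deriv u" and ?M = "lebesgue_on {x<..<y}"
  have conv: "set_lebesgue_integral lebesgue {x<..<y} f = integral\<^sup>L ?M f" for f :: "real \<Rightarrow> real"
    by (simp add: set_lebesgue_integral_def integral_restrict_space)
  have fin: "finite_measure ?M"
    by (rule finite_measure_lebesgue_on) (metis lmeasurable_box box_real(1))
  have sub: "integrable ?M f" if "integrable (lebesgue_on {0<..<1}) f" for f :: "real \<Rightarrow> real"
  proof -
    have "set_integrable lebesgue {x<..<y} f"
      by (rule set_integrable_subset[OF that[unfolded integrable_unit_interval_iff]]) (use xy in auto)
    then show ?thesis by (simp add: set_integrable_def integrable_restrict_space)
  qed
  note g = sobolev_weak_deriv(3)[OF u]
  have "integrable ?M ?g" "integrable ?M (\<lambda>t. \<bar>?g t\<bar> ^ p)"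
    using g Lp_space_imp_integrable[OF g p] by (auto intro!: sub simp: Lp_space_def)
  then have "\<bar>integral\<^sup>L ?M ?g\<bar> ^ p \<le> measure ?M (space ?M) ^ (p - 1) * (\<integral>t. \<bar>?g t\<bar> ^ p \<partial>?M)"
    by (intro finite_measure.abs_integral_power_le[OF fin _ _ p] borel_measurable_integrable)
      (use xy in \<open>auto simp: measure_lebesgue_on_Ioo\<close>)
  then show ?thesis
    unfolding sobolev_increment[OF u p xy] conv
    using xy by (simp only: space_lebesgue_on measure_lebesgue_on_Ioo)
qed

text \<open>Average \<open>\<bar>f s\<bar> \<le> \<bar>f x\<bar> + \<integral>\<bar>f'\<bar>\<close>
  over \<open>x\<close>. The unit interval has measure one, so the integrals of
  \<open>\<bar>f\<bar>\<close> and of its derivative are each at most the Sobolev norm, whence the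
  constant 2.\<close>

lemma eval_sobolev_dual:
  assumes p: "p \<ge> 1" and s: "0 \<le> s" "s < 1"
  shows "(\<lambda>f. f s) \<in> sobolev_dual p"
proof -
  let ?M = "lebesgue_on {0<..<1::real}"
  have bound: "\<bar>f s\<bar> \<le> 2 * sobolev_norm p f" if f: "f \<in> sobolev p" for f
  proof -
    let ?g = "weak_deriv f"
    interpret finite_measure ?M by (rule finite_measure_unit_interval)
    note w = sobolev_weak_deriv[OF f]
    have mM: "measure ?M (space ?M) = 1" using measure_lebesgue_on_Ioo[of 0 1] by simp
    have fi: "integrable ?M f" and gi: "integrable ?M ?g"
      using Lp_space_imp_integrable w p by blast+
    define A where "A = (LINT x|?M. \<bar>f x\<bar> ^ p)"
    define B where "B = (LINT x|?M. \<bar>?g x\<bar> ^ p)"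
    have nn: "A \<ge> 0" "B \<ge> 0" by (auto simp: A_def B_def)
    have norm: "sobolev_norm p f = root p (A + B)" by (simp add: sobolev_norm_def A_def B_def)
    have root_le: "c \<le> root p (A + B)" if "c ^ p \<le> A + B" "c \<ge> 0" for c
      using that p real_root_le_mono[of p "c ^ p" "A + B"] by (simp add: real_root_power_cancel)
    have absint: "integral\<^sup>L ?M (\<lambda>x. \<bar>h x\<bar>) \<le> root p (A + B)"
      if "h \<in> Lp_space p" "(LINT x|?M. \<bar>h x\<bar> ^ p) \<le> A + B" for h
    proof -
      have "\<bar>integral\<^sup>L ?M (\<lambda>x. \<bar>h x\<bar>)\<bar> ^ p \<le> 1 ^ (p - 1) * (LINT x|?M. \<bar>\<bar>h x\<bar>\<bar> ^ p)"
        using that p mM by (intro abs_integral_power_le[of "\<lambda>x. \<bar>h x\<bar>" p, simplified mM]) (auto simp: Lp_space_def)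
      then show ?thesis using that by (intro root_le) auto
    qed
    have F: "integral\<^sup>L ?M (\<lambda>x. \<bar>f x\<bar>) \<le> root p (A + B)"
      using nn by (intro absint w) (simp add: A_def)
    have G: "integral\<^sup>L ?M (\<lambda>x. \<bar>?g x\<bar>) \<le> root p (A + B)"
      using nn by (intro absint w) (simp add: B_def)
    have inc: "\<bar>f b - f a\<bar> \<le> integral\<^sup>L ?M (\<lambda>x. \<bar>?g x\<bar>)" if ab: "0 \<le> a" "a < b" "b < 1" for a b
    proof -
      have "\<bar>f b - f a\<bar> \<le> (LINT t:{a<..<b}|lebesgue. \<bar>?g t\<bar>)"
        unfolding sobolev_increment[OF f p ab] set_lebesgue_integral_def
        by (rule order_trans[OF integral_abs_bound]) (simp add: abs_mult)
      also have "\<dots> \<le> (LINT t:{0<..<1}|lebesgue. \<bar>?g t\<bar>)"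
      proof -
        have "set_integrable lebesgue {0<..<1} (\<lambda>t. \<bar>?g t\<bar>)"
          using gi by (subst integrable_unit_interval_iff[symmetric]) simp
        then show ?thesis
          unfolding set_lebesgue_integral_def set_integrable_def
          by (rule integral_mono') (use ab in \<open>auto simp: indicator_def\<close>)
      qed
      finally show ?thesis by (simp add: LINT_unit_interval)
    qed
    have "\<bar>f s\<bar> \<le> \<bar>f x\<bar> + root p (A + B)" if "x \<in> {0<..<1}" for x
    proof (rule linorder_cases[of x s])
      assume "x < s" then show ?thesis using inc[of x s] that s G by auto
    next
      assume "s < x" then show ?thesis using inc[of s x] that s G by auto
    next
      assume "x = s" then show ?thesis using nn p by (simp add: real_root_ge_zero)
    qed
    then have "integral\<^sup>L ?M (\<lambda>x. \<bar>f s\<bar>) \<le> integral\<^sup>L ?M (\<lambda>x. \<bar>f x\<bar> + root p (A + B))"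
      using fi by (intro integral_mono) auto
    also have "\<dots> = integral\<^sup>L ?M (\<lambda>x. \<bar>f x\<bar>) + root p (A + B)"
      using fi mM by (subst Bochner_Integration.integral_add) auto
    finally show ?thesis using F mM norm by simp
  qed
  then show ?thesis unfolding sobolev_dual_def by (auto intro!: exI[of _ 2])
qed

lemma sobolev_weak_conv_pointwise:
  assumes "sobolev_weak_conv p U u" "p \<ge> 1" "0 \<le> s" "s < 1"
  shows "(\<lambda>n. U n s) \<longlonglongrightarrow> u s"
proof -
  have "\<forall>L\<in>sobolev_dual p. (\<lambda>n. L (U n)) \<longlonglongrightarrow> L u"
    using assms(1) unfolding sobolev_weak_conv_def by blast
  from bspec[OF this eval_sobolev_dual[OF assms(2-4)]] show ?thesis .
qed

section \<open>Uniform bounds and weak continuity\<close>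

text \<open>Here \<open>d\<close> and \<open>e\<close> are the energies spent on
  \<open>(0, x)\<close> and \<open>(x, y)\<close>; their sum is bounded by the total energy 1, and
  each controls an increment by \<open>sobolev_holder\<close>.\<close>

lemma E_space_energy:
  assumes v: "v \<in> E_space N" and N: "N \<ge> 1" and xy: "0 \<le> x" "x < y" "y < 1"
  obtains d e where "d \<ge> 0" "e \<ge> 0" "d + e \<le> 1"
    "\<bar>v x\<bar> ^ N \<le> x ^ (N - 1) * d" "\<bar>v y - v x\<bar> ^ N \<le> (y - x) ^ (N - 1) * e"
proof -
  let ?g = "\<lambda>t. \<bar>weak_deriv v t\<bar> ^ N"
  have vs: "v \<in> sobolev N" and v0: "v 0 = 0" and tot: "(LINT t:{0<..<1}|lebesgue. ?g t) = 1"
    using v by (auto simp: E_space_def LINT_unit_interval)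
  have gi: "set_integrable lebesgue {0<..<1} ?g"
    using sobolev_weak_deriv(3)[OF vs] by (simp add: Lp_space_def integrable_unit_interval_iff)
  have sub: "set_integrable lebesgue A ?g" if "A \<subseteq> {0<..<1}" "A \<in> sets lebesgue" for A
    using set_integrable_subset[OF gi that(2,1)] .
  define d e where "d = (LINT t:{0<..<x}|lebesgue. ?g t)" and "e = (LINT t:{x<..<y}|lebesgue. ?g t)"
  show thesis
  proof (rule that[of d e])
    show "d \<ge> 0" "e \<ge> 0"
      unfolding d_def e_def set_lebesgue_integral_def by (auto intro!: Bochner_Integration.integral_nonneg)
    have "d + e = (LINT t:{0<..<x} \<union> {x<..<y}|lebesgue. ?g t)"
      unfolding d_def e_def by (rule set_integral_Un[symmetric]) (use xy in \<open>auto intro!: sub\<close>)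
    also have "\<dots> \<le> (LINT t:{0<..<1}|lebesgue. ?g t)"
      using gi unfolding set_lebesgue_integral_def set_integrable_def
      by (rule integral_mono') (use xy in \<open>auto simp: indicator_def\<close>)
    finally show "d + e \<le> 1" using tot by simp
    show "\<bar>v x\<bar> ^ N \<le> x ^ (N - 1) * d"
    proof (cases "x = 0")
      case False
      then show ?thesis using sobolev_holder[OF vs N, of 0 x] xy v0 by (simp add: d_def)
    next
      case True
      then show ?thesis using v0 N \<open>d \<ge> 0\<close> by (simp add: power_0_left)
    qed
    show "\<bar>v y - v x\<bar> ^ N \<le> (y - x) ^ (N - 1) * e"
      unfolding e_def by (rule sobolev_holder[OF vs N xy])
  qed
qed

text \<open>The energy spent on \<open>(0, s)\<close> is at most 1.\<close>

lemma E_space_power_le: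
  assumes "v \<in> E_space N" "N \<ge> 1" "0 < s" "s < 1"
  shows "\<bar>v s\<bar> ^ N / s ^ (N - 1) \<le> 1"
proof -
  from assms dense[of s 1] obtain y where y: "s < y" "y < 1" by auto
  obtain d e where de: "d \<ge> 0" "e \<ge> (0::real)" "d + e \<le> 1" "\<bar>v s\<bar> ^ N \<le> s ^ (N - 1) * d"
    by (rule E_space_energy[OF assms(1,2), of s y]) (use assms(3) y in auto)
  have "s ^ (N - 1) * d \<le> s ^ (N - 1)"
    using de assms by (intro mult_left_le) auto
  then have "\<bar>v s\<bar> ^ N \<le> s ^ (N - 1)" using de by linarith
  then show ?thesis using assms by (simp add: divide_le_eq)
qed

text \<open>If the quotient is almost maximal at \<open>x\<close>, then nearly all of the energy is spent on \<open>(0,x)\<close>,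
  so \<open>v\<close> can hardly grow after \<open>x\<close>.\<close>

lemma E_space_concentration:
  fixes N :: nat
  defines "\<epsilon> \<equiv> 1 / 2 ^ (N + 2)"
  assumes v: "v \<in> E_space N" and N: "N \<ge> 2" and xy: "0 < x" "x < y" "y < 1"
    and big: "\<bar>v x\<bar> ^ N / x ^ (N - 1) \<ge> 1 - \<epsilon>" "\<bar>v y\<bar> ^ N / y ^ (N - 1) \<ge> 1 - \<epsilon>"
  shows "y \<le> 2 ^ (N + 1) * x"
proof -
  obtain d e where de: "d \<ge> 0" "e \<ge> 0" "d + e \<le> 1"
    "\<bar>v x\<bar> ^ N \<le> x ^ (N - 1) * d" "\<bar>v y - v x\<bar> ^ N \<le> (y - x) ^ (N - 1) * e"
    by (rule E_space_energy[OF v, of x y]) (use N xy in auto)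
  have pos: "x ^ (N - 1) > 0" "y ^ (N - 1) > 0" using xy by auto
  have "(1 - \<epsilon>) * x ^ (N - 1) \<le> \<bar>v x\<bar> ^ N" using big(1) pos by (simp add: le_divide_eq)
  also have "\<dots> \<le> d * x ^ (N - 1)" using de(4) by (simp add: mult.commute)
  finally have "1 - \<epsilon> \<le> d" using pos by simp
  then have e: "e \<le> \<epsilon>" using de by simp
  \<comment> \<open>A crude form of convexity: the power of a sum is at most \<open>2 ^ N\<close>
    times the sum of the powers.\<close>
  have "\<bar>v y\<bar> ^ N \<le> (2 * max \<bar>v x\<bar> \<bar>v y - v x\<bar>) ^ N"
  proof (rule power_mono)
    have "\<bar>v y\<bar> \<le> \<bar>v x\<bar> + \<bar>v y - v x\<bar>" by simp
    then show "\<bar>v y\<bar> \<le> 2 * max \<bar>v x\<bar> \<bar>v y - v x\<bar>" by (simp add: max_def)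
  qed simp
  also have "\<dots> \<le> 2 ^ N * (\<bar>v x\<bar> ^ N + \<bar>v y - v x\<bar> ^ N)"
    unfolding power_mult_distrib
    by (rule mult_left_mono; cases "\<bar>v x\<bar> \<le> \<bar>v y - v x\<bar>") (simp_all add: max_absorb1 max_absorb2)
  also have "\<dots> \<le> 2 ^ N * (x ^ (N - 1) + \<epsilon> * y ^ (N - 1))"
  proof (intro mult_left_mono add_mono)
    show "\<bar>v x\<bar> ^ N \<le> x ^ (N - 1)"
      using E_space_power_le[OF v, of x] N xy by (simp add: divide_le_eq)
    have "(y - x) ^ (N - 1) * e \<le> y ^ (N - 1) * \<epsilon>"
      by (intro mult_mono power_mono) (use xy e de in auto)
    then show "\<bar>v y - v x\<bar> ^ N \<le> \<epsilon> * y ^ (N - 1)" using de by (simp add: mult.commute)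
  qed auto
  finally have "\<bar>v y\<bar> ^ N \<le> 2 ^ N * x ^ (N - 1) + (2 ^ N * \<epsilon>) * y ^ (N - 1)"
    by (simp add: algebra_simps)
  \<comment> \<open>The reason for the choice of \<open>\<epsilon>\<close>: the term in
    \<open>y\<close> on the right has coefficient \<open>1 / 4\<close> and is absorbed by the left
    side, whose coefficient is at least \<open>3 / 4\<close>.\<close>
  moreover have "2 ^ N * \<epsilon> = 1 / 4" by (simp add: \<epsilon>_def)
  moreover have "(1 - \<epsilon>) * y ^ (N - 1) \<le> \<bar>v y\<bar> ^ N" using big(2) pos by (simp add: le_divide_eq)
  ultimately have "(1 - \<epsilon>) * y ^ (N - 1) \<le> 2 ^ N * x ^ (N - 1) + 1 / 4 * y ^ (N - 1)" by simp
  moreover have "3 / 4 * y ^ (N - 1) \<le> (1 - \<epsilon>) * y ^ (N - 1)"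
  proof (rule mult_right_mono)
    have "(2::real) ^ 2 \<le> 2 ^ (N + 2)" by (intro power_increasing) auto
    then have "\<epsilon> \<le> 1 / 4" unfolding \<epsilon>_def by (intro divide_left_mono) auto
    then show "3 / 4 \<le> 1 - \<epsilon>" by simp
  qed (use pos in simp)
  ultimately have "y ^ (N - 1) \<le> 2 ^ (N + 1) * x ^ (N - 1)" by simp
  then have "(y / x) ^ (N - 1) \<le> 2 ^ (N + 1)"
    using pos by (simp add: power_divide divide_le_eq)
  \<comment> \<open>The base exceeds 1 and \<open>N - 1\<close> is at least 1, so the bound on the
    power bounds \<open>y / x\<close> itself.\<close>
  moreover have "(y / x) ^ 1 \<le> (y / x) ^ (N - 1)"
    by (intro power_increasing) (use N xy in auto)
  ultimately have "y / x \<le> 2 ^ (N + 1)" by simp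
  then show ?thesis using xy by (simp add: divide_le_eq)
qed

section \<open>Majorants and measurability of the integrand\<close>

abbreviation unit_interval_measure :: "real measure" where
  "unit_interval_measure \<equiv> lebesgue_on {0<..<1}"

text \<open>The left side is \<open>(e/s)\<close> to the power \<open>\<beta> * f\<close>, and the
  base is at least 1 on the unit interval, so a bound on the exponent suffices.\<close>

lemma exp_mult_ln_le_powr:
  fixes s \<beta> f c :: real
  assumes "0 < s" "s < 1" "\<beta> * f \<le> c"
  shows "exp (\<beta> * ln (exp 1 / s) * f) \<le> (exp 1 / s) powr c"
proof -
  have "ln (exp 1 / s) = 1 - ln s"
    using assms by (simp add: ln_div)
  then have "ln (exp 1 / s) \<ge> 0"
    using ln_less_zero[of s] assms by linarith
  then have "\<beta> * f * ln (exp 1 / s) \<le> c * ln (exp 1 / s)"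
    using assms by (intro mult_right_mono)
  then show ?thesis using assms by (simp add: powr_def mult_ac)
qed

lemma nn_integral_powr_finite:
  assumes "c < 1"
  shows "(\<integral>\<^sup>+s. ennreal ((exp 1 / s) powr c) \<partial>unit_interval_measure) < \<infinity>"
proof -
  have "(\<lambda>s::real. s powr (- c)) integrable_on {0..1}"
    by (rule integrable_on_powr_from_0) (use assms in auto)
  then have "(\<lambda>s::real. s powr (- c)) absolutely_integrable_on {0..1}"
    by (rule nonnegative_absolutely_integrable_1) auto
  then have "set_integrable lebesgue {0<..<1} (\<lambda>s::real. s powr (- c))"
    by (rule set_integrable_subset) auto
  then have "integrable unit_interval_measure (\<lambda>s. exp 1 powr c * s powr (- c))"
    unfolding integrable_unit_interval_iff[symmetric] by (rule integrable_mult_right)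
  then have "(\<integral>\<^sup>+s. ennreal (norm (exp 1 powr c * s powr (- c))) \<partial>unit_interval_measure) < \<infinity>"
    by (simp only: integrable_iff_bounded)
  also have "(\<integral>\<^sup>+s. ennreal (norm (exp 1 powr c * s powr (- c))) \<partial>unit_interval_measure)
      = (\<integral>\<^sup>+s. ennreal ((exp 1 / s) powr c) \<partial>unit_interval_measure)"
    by (rule nn_integral_cong) (auto simp: powr_divide powr_minus_divide)
  finally show ?thesis .
qed

lemma borel_measurable_lebesgue_on:
  assumes "f \<in> borel_measurable borel"
  shows "f \<in> borel_measurable (lebesgue_on S)"
  by (intro measurable_restrict_space1 measurable_completion) (use assms in simp)

text \<open>An inequality, because the interval may extend beyond the unit interval.\<close>

lemma nn_integral_const_Icc:
  assumes "a \<le> b" "c \<ge> 0"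
  shows "(\<integral>\<^sup>+s. ennreal c * indicator {a..b} s \<partial>unit_interval_measure) \<le> ennreal (c * (b - a))"
proof -
  have "(\<integral>\<^sup>+s. ennreal c * indicator {a..b} s \<partial>unit_interval_measure)
      = (\<integral>\<^sup>+s. ennreal c * indicator {a..b} s * indicator {0<..<1} s \<partial>lebesgue)"
    by (rule nn_integral_restrict_space) simp
  also have "\<dots> \<le> (\<integral>\<^sup>+s. ennreal c * indicator {a..b} s \<partial>lebesgue)"
    by (rule nn_integral_mono) (auto simp: indicator_def)
  also have "\<dots> = ennreal (c * (b - a))"
    using assms by (subst nn_integral_cmult_indicator) (auto simp: ennreal_mult)
  finally show ?thesis .
qed

lemma I_fun_integrand_measurable:
  assumes "continuous_on {0..1} v"
  shows "(\<lambda>s. exp (\<beta> * ln (exp 1 / s) * (\<bar>v s\<bar> ^ N / s ^ (N - 1)))) \<in> borel_measurable unit_interval_measure"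
proof -
  have "v \<in> borel_measurable unit_interval_measure"
    using integrable_continuous_unit_interval[OF assms] by (rule borel_measurable_integrable)
  moreover have "(\<lambda>s. \<beta> * ln (exp 1 / s)) \<in> borel_measurable unit_interval_measure"
    "(\<lambda>s::real. s ^ (N - 1)) \<in> borel_measurable unit_interval_measure"
    by (intro borel_measurable_lebesgue_on; measurable)+
  ultimately show ?thesis by measurable
qed

lemma I_fun_bounded:
  assumes N: "N \<ge> 2"
  obtains C where "C < \<infinity>" "\<And>\<beta> v. \<beta> \<le> 1 \<Longrightarrow> v \<in> E_space N \<Longrightarrow> I_fun N \<beta> v \<le> C"
proof -
  define \<epsilon> :: real where "\<epsilon> = 1 / 2 ^ (N + 2)"
  define K :: real where "K = 2 ^ (N + 1)"
  \<comment> \<open>The first summand covers the points off the concentration set. The second bounds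
    \<open>exp 1 * K / s0\<close> times the length of \<open>[s0 / K, K * s0]\<close>, in which
    \<open>s0\<close> cancels.\<close>
  define C where "C = (\<integral>\<^sup>+s. ennreal ((exp 1 / s) powr (1 - \<epsilon>)) \<partial>unit_interval_measure) + ennreal (exp 1 * K * K)"
  have \<epsilon>: "0 < \<epsilon>" by (simp add: \<epsilon>_def)
  have K: "K \<ge> 1" unfolding K_def by (rule one_le_power) simp
  have "C < \<infinity>"
    unfolding C_def infinity_ennreal_def ennreal_add_less_top
    using nn_integral_powr_finite[of "1 - \<epsilon>"] \<epsilon> ennreal_less_top by (intro conjI) (simp_all only: infinity_ennreal_def)
  moreover have "I_fun N \<beta> v \<le> C" if \<beta>: "\<beta> \<le> 1" and v: "v \<in> E_space N" for \<beta> v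
  proof -
    define f where "f s = \<bar>v s\<bar> ^ N / s ^ (N - 1)" for s
    have f: "0 \<le> f s" "f s \<le> 1" if "0 < s" "s < 1" for s
      using E_space_power_le[OF v, of s] N that by (auto simp: f_def)
    \<comment> \<open>Since \<open>f\<close> is nonnegative, every \<open>\<beta> \<le> 1\<close>,
      negative values included, is dominated by the case \<open>\<beta> = 1\<close>.\<close>
    have fle: "\<beta> * f s \<le> f s" if "0 < s" "s < 1" for s
      using mult_right_mono[OF \<beta> f(1)[OF that]] by simp
    define G where "G = {s\<in>{0<..<1}. f s \<ge> 1 - \<epsilon>}"
    have off: "exp (\<beta> * ln (exp 1 / s) * f s) \<le> (exp 1 / s) powr (1 - \<epsilon>)" if "s \<in> {0<..<1}" "s \<notin> G" for s
      by (rule exp_mult_ln_le_powr) (use that fle[of s] in \<open>auto simp: G_def\<close>)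
    have on: "exp (\<beta> * ln (exp 1 / s) * f s) \<le> exp 1 / s" if "s \<in> {0<..<1}" for s
      using exp_mult_ln_le_powr[of s \<beta> "f s" 1] that fle[of s] f[of s] by auto
    have conc: "y \<le> K * x" if "x \<in> G" "y \<in> G" for x y
    proof (cases "x < y")
      case True
      then show ?thesis
        using E_space_concentration[OF v N, of x y] that by (auto simp: G_def K_def \<epsilon>_def f_def)
    next
      case False
      then have "y \<le> 1 * x" by simp
      also have "\<dots> \<le> K * x" using K that by (intro mult_right_mono) (auto simp: G_def)
      finally show ?thesis .
    qed
    \<comment> \<open>Any point of \<open>G\<close> can serve as \<open>s0\<close>, since two points
      of \<open>G\<close> differ at most by the factor \<open>K\<close>; for empty \<open>G\<close>
      the value 1 is a dummy.\<close>
    obtain s0 where s0: "s0 > 0" "G \<subseteq> {s0 / K..K * s0}"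
    proof (cases "G = {}")
      case True
      then show ?thesis using that[of 1] by simp
    next
      case False
      then obtain s0 where "s0 \<in> G" by blast
      have "s0 > 0" using \<open>s0 \<in> G\<close> by (simp add: G_def)
      moreover have "G \<subseteq> {s0 / K..K * s0}"
      proof
        fix s assume "s \<in> G"
        then have "s \<le> K * s0" "s0 \<le> K * s" using conc \<open>s0 \<in> G\<close> by auto
        then show "s \<in> {s0 / K..K * s0}" using K by (simp add: divide_le_eq mult.commute)
      qed
      ultimately show ?thesis using that by blast
    qed
    let ?J = "{s0 / K..K * s0}" and ?c = "exp 1 * K / s0"
    have "I_fun N \<beta> v \<le> (\<integral>\<^sup>+s. ennreal ((exp 1 / s) powr (1 - \<epsilon>)) + ennreal ?c * indicator ?J s \<partial>unit_interval_measure)"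
      unfolding I_fun_def f_def[symmetric]
    proof (rule nn_integral_mono)
      fix s assume "s \<in> space unit_interval_measure"
      then have s: "s \<in> {0<..<1}" by simp
      show "ennreal (exp (\<beta> * ln (exp 1 / s) * f s))
          \<le> ennreal ((exp 1 / s) powr (1 - \<epsilon>)) + ennreal ?c * indicator ?J s"
      proof (cases "s \<in> G")
        case True
        then have J: "s \<in> ?J" using s0 by auto
        have "exp 1 / s \<le> exp 1 / (s0 / K)"
          using J s0 K s by (intro divide_left_mono mult_pos_pos) auto
        then have "exp (\<beta> * ln (exp 1 / s) * f s) \<le> ?c" using on[OF s] by simp
        then show ?thesis using J by (simp add: add_increasing ennreal_leI)
      next
        case False
        then show ?thesis using off[OF s] by (simp add: add_increasing2 ennreal_leI)
      qed
    qed
    also have "\<dots> = (\<integral>\<^sup>+s. ennreal ((exp 1 / s) powr (1 - \<epsilon>)) \<partial>unit_interval_measure)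
        + (\<integral>\<^sup>+s. ennreal ?c * indicator ?J s \<partial>unit_interval_measure)"
      by (rule nn_integral_add; rule borel_measurable_lebesgue_on) measurable
    also have "(\<integral>\<^sup>+s. ennreal ?c * indicator ?J s \<partial>unit_interval_measure) \<le> ennreal (?c * (K * s0 - s0 / K))"
    proof (rule nn_integral_const_Icc)
      have "s0 / K \<le> s0 / 1" using s0 K by (intro divide_left_mono) auto
      also have "\<dots> \<le> K * s0" using s0 K by simp
      finally show "s0 / K \<le> K * s0" .
    qed (use s0 K in simp)
    also have "?c * (K * s0 - s0 / K) \<le> ?c * (K * s0)"
      using s0 K by (intro mult_left_mono) auto
    also have "?c * (K * s0) = exp 1 * K * K" using s0 by simp
    finally show ?thesis by (simp add: C_def add_left_mono ennreal_leI)
  qed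
  ultimately show thesis using that by blast
qed

text \<open>Dominated convergence. The weak limit \<open>u\<close> may have lost energy, so the
  bound by 1 is used for the \<open>U n\<close> only, while \<open>u\<close> enters through
  pointwise convergence. The exponent \<open>max \<beta> 0\<close> covers negative
  \<open>\<beta>\<close> as well.\<close>

lemma I_fun_weakly_continuous:
  assumes N: "N \<ge> 2" and \<beta>: "\<beta> < 1" and U: "\<And>n. U n \<in> E_space N" and w: "sobolev_weak_conv N U u"
  shows "(\<lambda>n. I_fun N \<beta> (U n)) \<longlonglongrightarrow> I_fun N \<beta> u"
  unfolding I_fun_def
proof (rule nn_integral_dominated_convergence[where w = "\<lambda>s. ennreal ((exp 1 / s) powr max \<beta> 0)"])
  show "(\<lambda>s. ennreal (exp (\<beta> * ln (exp 1 / s) * (\<bar>U n s\<bar> ^ N / s ^ (N - 1))))) \<in> borel_measurable unit_interval_measure" for n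
    using U[of n] by (intro measurable_compose[OF I_fun_integrand_measurable measurable_ennreal])
      (auto simp: E_space_def sobolev_def)
  show "(\<lambda>s. ennreal (exp (\<beta> * ln (exp 1 / s) * (\<bar>u s\<bar> ^ N / s ^ (N - 1))))) \<in> borel_measurable unit_interval_measure"
    using w by (intro measurable_compose[OF I_fun_integrand_measurable measurable_ennreal])
      (auto simp: sobolev_weak_conv_def sobolev_def)
  show "(\<lambda>s. ennreal ((exp 1 / s) powr max \<beta> 0)) \<in> borel_measurable unit_interval_measure"
    by (rule borel_measurable_lebesgue_on) measurable
  show "(\<integral>\<^sup>+s. ennreal ((exp 1 / s) powr max \<beta> 0) \<partial>unit_interval_measure) < \<infinity>"
    by (rule nn_integral_powr_finite) (use \<beta> in auto)
  show "AE s in unit_interval_measure. ennreal (exp (\<beta> * ln (exp 1 / s) * (\<bar>U n s\<bar> ^ N / s ^ (N - 1))))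
      \<le> ennreal ((exp 1 / s) powr max \<beta> 0)" for n
  proof (rule AE_I2, rule ennreal_leI, rule exp_mult_ln_le_powr)
    fix s assume "s \<in> space unit_interval_measure"
    then show s: "0 < s" "s < 1" by auto
    have f: "0 \<le> \<bar>U n s\<bar> ^ N / s ^ (N - 1)" "\<bar>U n s\<bar> ^ N / s ^ (N - 1) \<le> 1"
      using E_space_power_le[OF U[of n], of s] N s by auto
    have "\<beta> * (\<bar>U n s\<bar> ^ N / s ^ (N - 1)) \<le> max \<beta> 0 * (\<bar>U n s\<bar> ^ N / s ^ (N - 1))"
      using f by (intro mult_right_mono) auto
    also have "\<dots> \<le> max \<beta> 0" using f by (intro mult_left_le) auto
    finally show "\<beta> * (\<bar>U n s\<bar> ^ N / s ^ (N - 1)) \<le> max \<beta> 0" .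
  qed
  show "AE s in unit_interval_measure. (\<lambda>n. ennreal (exp (\<beta> * ln (exp 1 / s) * (\<bar>U n s\<bar> ^ N / s ^ (N - 1)))))
      \<longlonglongrightarrow> ennreal (exp (\<beta> * ln (exp 1 / s) * (\<bar>u s\<bar> ^ N / s ^ (N - 1))))"
  proof (rule AE_I2)
    fix s assume "s \<in> space unit_interval_measure"
    then have s: "0 < s" "s < 1" by auto
    then have "(\<lambda>n. U n s) \<longlonglongrightarrow> u s"
      using sobolev_weak_conv_pointwise[OF w] N by auto
    then show "(\<lambda>n. ennreal (exp (\<beta> * ln (exp 1 / s) * (\<bar>U n s\<bar> ^ N / s ^ (N - 1)))))
      \<longlonglongrightarrow> ennreal (exp (\<beta> * ln (exp 1 / s) * (\<bar>u s\<bar> ^ N / s ^ (N - 1))))"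
      using s by (intro tendsto_intros) auto
  qed
qed

section \<open>The Moser sequence\<close>

lemma locally_integrableI:
  assumes "integrable unit_interval_measure f"
  shows "locally_integrable f"
  unfolding locally_integrable_def
proof (intro allI impI)
  fix K :: "real set" assume "compact K" "K \<subseteq> {0<..<1}"
  then show "f absolutely_integrable_on K"
    by (intro set_integrable_subset[OF assms[unfolded integrable_unit_interval_iff]])
      (auto intro: fmeasurableD lmeasurable_compact)
qed

text \<open>Integration by parts: \<open>u \<phi>\<close> is a continuous primitive of \<open>g \<phi> + u \<phi>'\<close> off the
  finite set \<open>A\<close>, and it vanishes at both ends.\<close>

lemma has_weak_derivI:
  fixes u g :: "real \<Rightarrow> real"
  assumes u: "continuous_on {0..1} u" and A: "finite A"
    and d: "\<And>x. x \<in> {0<..<1} - A \<Longrightarrow> (u has_real_derivative g x) (at x)"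
    and g: "g \<in> borel_measurable unit_interval_measure" "\<And>x. \<bar>g x\<bar> \<le> C"
  shows "has_weak_deriv u g"
proof -
  interpret finite_measure unit_interval_measure by (rule finite_measure_unit_interval)
  have gi: "integrable unit_interval_measure g"
    by (rule integrable_const_bound[of _ C]) (use g in auto)
  have "(LINT x|unit_interval_measure. u x * deriv \<phi> x) = - (LINT x|unit_interval_measure. g x * \<phi> x)"
    if \<phi>: "test_function \<phi>" for \<phi>
  proof -
    have sm: "smooth \<phi>" using \<phi> by (simp add: test_function_def smooth_def)
    note cont = smooth_continuous_on[OF sm] smooth_continuous_on[OF smooth_deriv[OF sm]]
    \<comment> \<open>The support lies in the open interval, so the boundary terms vanish.\<close>
    have ends: "\<phi> 0 = 0" "\<phi> 1 = 0"
      using \<phi> closure_subset[of "{x. \<phi> x \<noteq> 0}"] unfolding test_function_def by force+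
    have i1: "integrable unit_interval_measure (\<lambda>x. u x * deriv \<phi> x)"
      by (intro integrable_continuous_unit_interval continuous_intros u cont)
    have i2: "integrable unit_interval_measure (\<lambda>x. g x * \<phi> x)"
    proof -
      have phi: "integrable unit_interval_measure \<phi>"
        by (intro integrable_continuous_unit_interval cont)
      show ?thesis
      proof (rule Bochner_Integration.integrable_bound)
        show "integrable unit_interval_measure (\<lambda>x. C * \<phi> x)"
          using phi by simp
        show "(\<lambda>x. g x * \<phi> x) \<in> borel_measurable unit_interval_measure"
          using borel_measurable_integrable[OF phi] g(1) by measurable
        show "AE x in unit_interval_measure. norm (g x * \<phi> x) \<le> norm (C * \<phi> x)"
          by (rule AE_I2) (auto simp: abs_mult intro!: mult_right_mono order_trans[OF g(2) abs_ge_self])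
      qed
    qed
    have "((\<lambda>x. u x * deriv \<phi> x + g x * \<phi> x) has_integral u 1 * \<phi> 1 - u 0 * \<phi> 0) {0..1}"
    proof (rule fundamental_theorem_of_calculus_interior_strong[OF A])
      fix x assume x: "x \<in> {0<..<1} - A"
      show "((\<lambda>x. u x * \<phi> x) has_vector_derivative u x * deriv \<phi> x + g x * \<phi> x) (at x)"
        using DERIV_mult[OF d[OF x] smooth_has_deriv[OF sm, of x]]
        by (simp add: has_real_derivative_iff_has_vector_derivative add.commute mult.commute)
    qed (auto intro!: continuous_intros u cont)
    then have "integral {0<..<1} (\<lambda>x. u x * deriv \<phi> x + g x * \<phi> x) = 0"
      using ends by (auto simp: has_integral_Icc_iff_Ioo intro: integral_unique)
    then have "(LINT x|unit_interval_measure. u x * deriv \<phi> x + g x * \<phi> x) = 0"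
      using i1 i2 by (subst lebesgue_integral_eq_integral) auto
    then show ?thesis using i1 i2 by simp
  qed
  then show ?thesis
    using integrable_continuous_unit_interval[OF u] gi
    by (simp add: has_weak_deriv_def locally_integrableI)
qed

text \<open>One formula for both branches, from \<open>-(N - 1) / N = 1 / N - 1\<close>; continuity
  and the slopes can be read off it.\<close>

lemma moser_alt:
  assumes "j \<ge> 1" "N \<ge> 1"
  shows "moser N j t = real j powr (1 / real N) * min t (1 / real j)"
proof -
  have "- ((real N - 1) / real N) = 1 / real N + (- 1)" using assms by (simp add: field_simps)
  then have "real j powr (- ((real N - 1) / real N)) = real j powr (1 / real N) * (1 / real j)"
    using assms by (simp only: powr_add) (simp add: powr_minus_divide)
  then show ?thesis using assms by (auto simp: moser_def min_def)
qed

text \<open>The weak derivative is \<open>j powr (1 / N)\<close> up to \<open>1 / j\<close> and zero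
  afterwards, so the energy is \<open>j * (1 / j) = 1\<close>. The kink at \<open>1 / j\<close> is
  the exceptional point in \<open>has_weak_derivI\<close>.\<close>

lemma moser_in_E_space:
  assumes j: "j \<ge> 1" and N: "N \<ge> 1"
  shows "moser N j \<in> E_space N"
proof -
  define c where "c = real j powr (1 / real N)"
  define g where "g t = c * indicat_real {..1 / real j} t" for t
  have m: "moser N j = (\<lambda>t. c * min t (1 / real j))"
    using moser_alt[OF assms] by (auto simp: c_def)
  have cont: "continuous_on {0..1} (moser N j)"
    unfolding m by (intro continuous_intros)
  have cN: "\<bar>c\<bar> ^ N = real j"
    using j N by (simp add: c_def powr_power)
  have gm: "g \<in> borel_measurable borel" unfolding g_def by measurable
  have w: "has_weak_deriv (moser N j) g"
  proof (rule has_weak_derivI[OF cont, of "{1 / real j}" g "\<bar>c\<bar>"])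
    fix x assume "x \<in> {0<..<1} - {1 / real j}"
    then consider "x < 1 / real j" | "x > 1 / real j" by fastforce
    then show "(moser N j has_real_derivative g x) (at x)"
    proof cases
      case 1
      have ev: "eventually (\<lambda>t. moser N j t = c * t) (nhds x)"
        by (rule eventually_mono[OF eventually_nhds_in_open[of "{..<1 / real j}" x]]) (use 1 in \<open>auto simp: m\<close>)
      show ?thesis
        using 1 by (subst DERIV_cong_ev[OF refl ev refl]) (auto simp: g_def intro!: derivative_eq_intros)
    next
      case 2
      have ev: "eventually (\<lambda>t. moser N j t = c * (1 / real j)) (nhds x)"
        by (rule eventually_mono[OF eventually_nhds_in_open[of "{1 / real j<..}" x]]) (use 2 in \<open>auto simp: m\<close>)
      show ?thesis
        using 2 by (subst DERIV_cong_ev[OF refl ev refl]) (auto simp: g_def intro!: derivative_eq_intros)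
    qed
  qed (auto simp: g_def[of x for x] abs_mult indicator_def intro!: borel_measurable_lebesgue_on gm)
  have gN: "\<bar>g t\<bar> ^ N = real j * indicat_real {..1 / real j} t" for t
    using cN N by (auto simp: g_def indicator_def)
  interpret finite_measure unit_interval_measure by (rule finite_measure_unit_interval)
  have gL: "g \<in> Lp_space N"
  proof -
    have "integrable unit_interval_measure (\<lambda>t. \<bar>g t\<bar> ^ N)"
      by (rule integrable_const_bound[of _ "real j"])
        (auto simp: gN indicator_def intro!: borel_measurable_lebesgue_on)
    then show ?thesis using gm by (simp add: Lp_space_def borel_measurable_lebesgue_on)
  qed
  have mL: "moser N j \<in> Lp_space N"
  proof -
    have "integrable unit_interval_measure (\<lambda>t. \<bar>moser N j t\<bar> ^ N)" "integrable unit_interval_measure (moser N j)"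
      by (intro integrable_continuous_unit_interval continuous_intros cont)+
    then show ?thesis by (simp add: Lp_space_def borel_measurable_integrable)
  qed
  have "(LINT t|unit_interval_measure. \<bar>g t\<bar> ^ N) = 1"
  proof -
    \<comment> \<open>For \<open>j = 1\<close> the point \<open>1 / j\<close> is the excluded right
      end, so the intersection is open there.\<close>
    have "{0<..<1} \<inter> {..1 / real j} = (if j = 1 then {0<..<1} else {0<..1 / real j})"
    proof (cases "j = 1")
      case False
      then have "1 / real j < 1" using j by simp
      then show ?thesis using False by auto
    qed auto
    then have "measure lebesgue ({0<..<1} \<inter> {..1 / real j}) = 1 / real j"
      by auto
    moreover have "(LINT t|unit_interval_measure. \<bar>g t\<bar> ^ N)
        = real j * (LINT t|lebesgue. indicat_real ({0<..<1} \<inter> {..1 / real j}) t)"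
      unfolding gN LINT_unit_interval set_lebesgue_integral_def
      by (subst integral_mult_right_zero[symmetric], rule Bochner_Integration.integral_cong)
        (auto simp: indicator_def)
    ultimately show ?thesis using j by simp
  qed
  moreover have "moser N j 0 = 0" using j by (simp add: m)
  ultimately show ?thesis
    using weak_deriv_Lp_space(2)[OF w gL cont] cont mL w gL
    by (auto simp: E_space_def sobolev_def)
qed

section \<open>The functional along the Moser sequence\<close>

lemma moser_quotient:
  assumes j: "j \<ge> 1" and N: "N \<ge> 1" and s: "s > 0"
  shows "\<bar>moser N j s\<bar> ^ N / s ^ (N - 1) =
    (if s \<le> 1 / real j then real j * s else (1 / (real j * s)) ^ (N - 1))"
proof -
  have "\<bar>moser N j s\<bar> ^ N = real j * min s (1 / real j) ^ N"
    using assms by (simp add: moser_alt abs_mult power_mult_distrib powr_power)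
  also have "\<dots> / s ^ (N - 1) = (if s \<le> 1 / real j then real j * s else (1 / (real j * s)) ^ (N - 1))"
    using assms by (cases N) (auto simp: min_def power_divide power_mult_distrib)
  finally show ?thesis .
qed

lemma I_fun_zero: "N \<ge> 1 \<Longrightarrow> I_fun N \<beta> (\<lambda>_. 0) = 1"
  by (simp add: I_fun_def power_0_left emeasure_restrict_space)

lemma I_fun_moser_tendsto_infinity:
  assumes N: "N \<ge> 1" and \<beta>: "\<beta> > 1"
  shows "(\<lambda>j. I_fun N \<beta> (moser N j)) \<longlonglongrightarrow> \<infinity>"
proof -
  \<comment> \<open>Chosen so that \<open>\<gamma> = (\<beta> + 1) / 2\<close>, which still exceeds
    1.\<close>
  define \<delta> where "\<delta> = (\<beta> - 1) / (2 * \<beta>)"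
  define \<gamma> where "\<gamma> = \<beta> * (1 - \<delta>)"
  have \<delta>: "0 < \<delta>" "\<delta> < 1" using \<beta> by (auto simp: \<delta>_def field_simps)
  have "\<gamma> = (\<beta> + 1) / 2" using \<beta> by (simp add: \<gamma>_def \<delta>_def field_simps)
  then have \<gamma>: "\<gamma> > 1" using \<beta> by simp
  \<comment> \<open>On the window \<open>?J\<close> of length \<open>\<delta> / j\<close> the
    integrand is at least \<open>j powr \<gamma>\<close>. From \<open>j = 2\<close> on, the window
    lies inside the unit interval.\<close>
  have low: "ennreal (\<delta> * real j powr (\<gamma> - 1)) \<le> I_fun N \<beta> (moser N j)" if j: "j \<ge> 2" for j
  proof -
    let ?J = "{(1 - \<delta>) / real j<..<1 / real j}"
    have J: "?J \<subseteq> {0<..<1}"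
    proof
      fix s assume "s \<in> ?J"
      moreover have "0 < (1 - \<delta>) / real j" "1 / real j < 1" using \<delta> j by auto
      ultimately show "s \<in> {0<..<1}" by simp
    qed
    have "ennreal (\<delta> * real j powr (\<gamma> - 1)) = ennreal (real j powr \<gamma>) * emeasure lebesgue ?J"
    proof -
      have "(1 - \<delta>) / real j \<le> 1 / real j" using \<delta> j by (intro divide_right_mono) auto
      then have "emeasure lebesgue ?J = ennreal (1 / real j - (1 - \<delta>) / real j)" by simp
      also have "1 / real j - (1 - \<delta>) / real j = \<delta> / real j" by (simp add: diff_divide_distrib)
      finally show ?thesis
        using j \<delta> by (simp add: ennreal_mult[symmetric] powr_diff)
    qed
    also have "\<dots> = (\<integral>\<^sup>+s. ennreal (real j powr \<gamma>) * indicator ?J s \<partial>lebesgue)"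
      by (rule nn_integral_cmult_indicator[symmetric]) simp
    also have "\<dots> = (\<integral>\<^sup>+s. ennreal (real j powr \<gamma>) * indicator ?J s \<partial>unit_interval_measure)"
      by (subst nn_integral_restrict_space, simp, rule nn_integral_cong) (use J in \<open>auto simp: indicator_def\<close>)
    also have "\<dots> \<le> I_fun N \<beta> (moser N j)"
      unfolding I_fun_def
    proof (rule nn_integral_mono)
      fix s assume "s \<in> space unit_interval_measure"
      then have s: "0 < s" "s < 1" by auto
      show "ennreal (real j powr \<gamma>) * indicator ?J s
          \<le> ennreal (exp (\<beta> * ln (exp 1 / s) * (\<bar>moser N j s\<bar> ^ N / s ^ (N - 1))))"
      proof (cases "s \<in> ?J")
        case True
        have js: "real j * s \<ge> 1 - \<delta>" "real j * s < 1"
          using True j by (auto simp: field_simps)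
        \<comment> \<open>Gives \<open>ln (exp 1 / s) \<ge> ln j\<close>; together with
          \<open>j * s \<ge> 1 - \<delta>\<close> this bounds the exponent from below.\<close>
        have "real j * s \<le> exp 1" using js(2) exp_gt_one[of 1] by linarith
        then have "real j \<le> exp 1 / s" using s by (simp add: le_divide_eq)
        then have "ln (real j) \<le> ln (exp 1 / s)" using j s by simp
        moreover have "ln (real j) \<ge> 0" using j by simp
        ultimately have "\<beta> * ln (real j) * (1 - \<delta>) \<le> \<beta> * ln (exp 1 / s) * (real j * s)"
          using js \<beta> \<delta> by (intro mult_mono) auto
        then have "real j powr \<gamma> \<le> exp (\<beta> * ln (exp 1 / s) * (real j * s))"
          using j by (simp add: powr_def \<gamma>_def mult_ac)
        then show ?thesis
          using True moser_quotient[OF _ N s(1), of j] j by (simp add: ennreal_leI)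
      qed simp
    qed
    finally show ?thesis .
  qed
  have "filterlim (\<lambda>j. \<delta> * real j powr (\<gamma> - 1)) at_top sequentially"
    using \<delta> \<gamma> by real_asymp
  then have "(\<lambda>j. ennreal (\<delta> * real j powr (\<gamma> - 1))) \<longlonglongrightarrow> \<infinity>"
    by (simp add: ennreal_tendsto_top_eq_at_top)
  then show ?thesis
    by (rule tendsto_sandwich[OF _ _ _ tendsto_const, rotated 2])
      (auto intro!: eventually_sequentiallyI[of 2] low)
qed

lemma I_fun_moser_tendsto_1:
  assumes N: "N \<ge> 2"
  shows "(\<lambda>j. I_fun N 1 (moser N j)) \<longlonglongrightarrow> 1"
proof -
  define f where "f j s = \<bar>moser N j s\<bar> ^ N / s ^ (N - 1)" for j s
  define h where "h j s = exp (1 * ln (exp 1 / s) * f j s)" for j s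
  have I: "I_fun N 1 (moser N j) = (\<integral>\<^sup>+s. ennreal (h j s) \<partial>unit_interval_measure)" for j
    by (simp add: I_fun_def h_def f_def)
  have f: "f j s = (if s \<le> 1 / real j then real j * s else (1 / (real j * s)) ^ (N - 1))"
    if "j \<ge> 1" "s > 0" for j s
    using moser_quotient[OF that(1) _ that(2), of N] N by (simp add: f_def)
  have total: "(\<integral>\<^sup>+s. 1 \<partial>unit_interval_measure) = 1"
    by (simp add: emeasure_restrict_space)
  have h_ge: "1 \<le> h j s" if "0 < s" "s < 1" for j s
  proof -
    have "ln (exp 1 / s) = 1 - ln s" using that by (simp add: ln_div)
    then have "ln (exp 1 / s) \<ge> 0" using ln_less_zero[of s] that by linarith
    moreover have "f j s \<ge> 0" using that by (simp add: f_def)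
    ultimately show ?thesis by (simp add: h_def)
  qed
  have lower: "1 \<le> I_fun N 1 (moser N j)" for j
    unfolding I by (subst total[symmetric], rule nn_integral_mono) (use h_ge in auto)
  \<comment> \<open>The base is at most 1 and the exponent \<open>N - 1\<close> at least 1, so one
    bound serves all \<open>N\<close>.\<close>
  have fone: "f j s \<le> 1 / (real j * s)" if "j \<ge> 1" "s > 0" "s > 1 / real j" for j s
  proof -
    have "1 / (real j * s) \<le> 1" using that by (simp add: divide_less_eq divide_le_eq mult.commute)
    then have "(1 / (real j * s)) ^ (N - 1) \<le> (1 / (real j * s)) ^ 1"
      using N that by (intro power_decreasing) auto
    then show ?thesis using f that by simp
  qed
  have upper: "eventually (\<lambda>j. I_fun N 1 (moser N j) < ennreal r) sequentially" if r: "r > 1" for r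
  proof -
    \<comment> \<open>The window then contributes at most \<open>4 * exp 1 * \<delta>\<close>, which
      is at most half of the margin \<open>r - 1\<close>.\<close>
    define \<delta> where "\<delta> = min (1 / 2) ((r - 1) / (8 * exp 1))"
    have \<delta>: "0 < \<delta>" "\<delta> \<le> 1 / 2" "4 * exp 1 * \<delta> \<le> (r - 1) / 2"
      using r by (auto simp: \<delta>_def min_def field_simps)
    \<comment> \<open>The integrand with the window around \<open>1 / j\<close> replaced by the
      constant 1; this part has an integrable majorant independent of \<open>j\<close>.\<close>
    define g where "g j s = (if \<bar>real j * s - 1\<bar> < \<delta> then 1 else h j s)" for j s
    \<comment> \<open>Outside the window, \<open>f\<close> is at most \<open>1 - \<delta>\<close> on
      the rising branch and at most \<open>1 / (1 + \<delta>)\<close> on the decaying one; both are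
      below \<open>1 - \<delta> / 2\<close>.\<close>
    have bound: "h j s \<le> (exp 1 / s) powr (1 - \<delta> / 2)"
      if j: "j \<ge> 1" and s: "0 < s" "s < 1" and far: "\<not> \<bar>real j * s - 1\<bar> < \<delta>" for j s
      unfolding h_def
    proof (rule exp_mult_ln_le_powr[OF s])
      show "1 * f j s \<le> 1 - \<delta> / 2"
      proof (cases "s \<le> 1 / real j")
        case True
        then have "real j * s \<le> 1" using j by (simp add: le_divide_eq mult.commute)
        then show ?thesis using True f[OF j s(1)] far \<delta> by auto
      next
        case False
        then have "1 / real j < s" by linarith
        then have "1 < real j * s" using j pos_divide_less_eq[of "real j" 1 s] by (simp add: mult.commute)
        then have "1 + \<delta> \<le> real j * s" using far by auto
        then have "1 / (real j * s) \<le> 1 / (1 + \<delta>)" using \<delta> by (intro divide_left_mono) auto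
        also have "1 / (1 + \<delta>) \<le> 1 - \<delta> / 2"
        proof -
          have "\<delta> * \<delta> \<le> \<delta> * 1" using \<delta> by (intro mult_left_mono) auto
          then have "1 \<le> (1 - \<delta> / 2) * (1 + \<delta>)" by (simp add: algebra_simps)
          then show ?thesis using \<delta> by (simp add: divide_le_eq)
        qed
        finally show ?thesis using fone[OF j s(1)] False by simp
      qed
    qed
    have hm: "h j \<in> borel_measurable unit_interval_measure" if "j \<ge> 1" for j
      unfolding h_def f_def
      using moser_in_E_space[OF that, of N] N
      by (intro I_fun_integrand_measurable) (auto simp: E_space_def sobolev_def)
    have gm: "(\<lambda>s. ennreal (g j s)) \<in> borel_measurable unit_interval_measure" if "j \<ge> 1" for j
    proof -
      have "{s. \<bar>real j * s - 1\<bar> < \<delta>} \<in> sets borel" by measurable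
      then have "Measurable.pred unit_interval_measure (\<lambda>s. \<bar>real j * s - 1\<bar> < \<delta>)"
        by (intro measurable_restrict_space1 measurable_completion) (simp add: pred_def)
      then show ?thesis
        unfolding g_def using hm[OF that] by measurable
    qed
    \<comment> \<open>The shift to \<open>Suc j\<close> avoids the junk value at
      \<open>j = 0\<close>; \<open>LIMSEQ_imp_Suc\<close> undoes it.\<close>
    have lim: "(\<lambda>j. \<integral>\<^sup>+s. ennreal (g (Suc j) s) \<partial>unit_interval_measure)
        \<longlonglongrightarrow> (\<integral>\<^sup>+s. 1 \<partial>unit_interval_measure)"
    proof (rule nn_integral_dominated_convergence[where w = "\<lambda>s. ennreal ((exp 1 / s) powr (1 - \<delta> / 2))"])
      show "(\<lambda>s. ennreal (g (Suc j) s)) \<in> borel_measurable unit_interval_measure" for j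
        by (rule gm) simp
      show "(\<lambda>s. ennreal ((exp 1 / s) powr (1 - \<delta> / 2))) \<in> borel_measurable unit_interval_measure"
        by (rule borel_measurable_lebesgue_on) measurable
      show "(\<integral>\<^sup>+s. ennreal ((exp 1 / s) powr (1 - \<delta> / 2)) \<partial>unit_interval_measure) < \<infinity>"
        by (rule nn_integral_powr_finite) (use \<delta> in simp)
      show "AE s in unit_interval_measure. ennreal (g (Suc j) s) \<le> ennreal ((exp 1 / s) powr (1 - \<delta> / 2))" for j
      proof (rule AE_I2, rule ennreal_leI)
        fix s assume "s \<in> space unit_interval_measure"
        then have s: "0 < s" "s < 1" by auto
        have "s \<le> exp 1" using s exp_gt_one[of "1::real"] by linarith
        then have "1 \<le> exp 1 / s" using s by (simp add: le_divide_eq)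
        then have "1 \<le> (exp 1 / s) powr (1 - \<delta> / 2)" using \<delta> by (intro ge_one_powr_ge_zero) auto
        then show "g (Suc j) s \<le> (exp 1 / s) powr (1 - \<delta> / 2)"
          using bound[of "Suc j" s] s by (auto simp: g_def)
      qed
      show "AE s in unit_interval_measure. (\<lambda>j. ennreal (g (Suc j) s)) \<longlonglongrightarrow> 1"
      proof (rule AE_I2)
        fix s assume "s \<in> space unit_interval_measure"
        then have s: "0 < s" "s < 1" by auto
        have "(\<lambda>j. 1 / (real (Suc j) * s)) \<longlonglongrightarrow> 0" using s by real_asymp
        then have l: "(\<lambda>j. exp (1 * ln (exp 1 / s) * (1 / (real (Suc j) * s)))) \<longlonglongrightarrow> exp (1 * ln (exp 1 / s) * 0)"
          by (intro tendsto_exp tendsto_mult tendsto_const)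
        have ev: "eventually (\<lambda>j. 1 / real (Suc j) < s) sequentially"
          by (rule order_tendstoD(2)[OF _ s(1)]) real_asymp
        have "(\<lambda>j. g (Suc j) s) \<longlonglongrightarrow> 1"
        proof (rule tendsto_sandwich[OF _ _ tendsto_const])
          show "(\<lambda>j. exp (1 * ln (exp 1 / s) * (1 / (real (Suc j) * s)))) \<longlonglongrightarrow> 1"
            using l by simp
          show "eventually (\<lambda>j. 1 \<le> g (Suc j) s) sequentially"
            using h_ge[OF s] by (auto simp: g_def)
          show "eventually (\<lambda>j. g (Suc j) s \<le> exp (1 * ln (exp 1 / s) * (1 / (real (Suc j) * s)))) sequentially"
            using ev
          proof eventually_elim
            case (elim j)
            have L: "ln (exp 1 / s) \<ge> 0"
            proof -
              have "ln (exp 1 / s) = 1 - ln s" using s by (simp add: ln_div)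
              then show ?thesis using ln_less_zero[of s] s by linarith
            qed
            have "h (Suc j) s \<le> exp (1 * ln (exp 1 / s) * (1 / (real (Suc j) * s)))"
              unfolding h_def exp_le_cancel_iff
              by (rule mult_left_mono) (use fone[of "Suc j" s] elim s L in auto)
            then show ?case
              unfolding g_def using h_ge[OF s, of "Suc j"] by (auto simp only: split: if_split intro: order_trans)
          qed
        qed
        then show "(\<lambda>j. ennreal (g (Suc j) s)) \<longlonglongrightarrow> 1"
          by (metis ennreal_1 tendsto_ennrealI)
      qed
    qed simp
    then have lim': "(\<lambda>j. \<integral>\<^sup>+s. ennreal (g j s) \<partial>unit_interval_measure) \<longlonglongrightarrow> 1"
      unfolding total by (rule LIMSEQ_imp_Suc)
    \<comment> \<open>On the window \<open>s\<close> is at least \<open>1 / (2 * j)\<close>, so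
      \<open>exp 1 / s\<close> is at most \<open>2 * exp 1 * j\<close>, and the window has length
      \<open>2 * \<delta> / j\<close>.\<close>
    have near: "I_fun N 1 (moser N j) \<le> (\<integral>\<^sup>+s. ennreal (g j s) \<partial>unit_interval_measure) + ennreal ((r - 1) / 2)"
      if j: "j \<ge> 1" for j
    proof -
      let ?J = "{(1 - \<delta>) / real j..(1 + \<delta>) / real j}"
      have "I_fun N 1 (moser N j) \<le> (\<integral>\<^sup>+s. ennreal (g j s) + ennreal (2 * exp 1 * real j) * indicator ?J s \<partial>unit_interval_measure)"
        unfolding I
      proof (rule nn_integral_mono)
        fix s assume "s \<in> space unit_interval_measure"
        then have s: "0 < s" "s < 1" by auto
        show "ennreal (h j s) \<le> ennreal (g j s) + ennreal (2 * exp 1 * real j) * indicator ?J s"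
        proof (cases "\<bar>real j * s - 1\<bar> < \<delta>")
          case True
          then have js: "1 - \<delta> \<le> s * real j" "s * real j \<le> 1 + \<delta>" by (auto simp: mult.commute)
          then have "s \<in> ?J" using j by (auto simp: divide_le_eq le_divide_eq)
          moreover have "h j s \<le> 2 * exp 1 * real j"
          proof -
            have "f j s \<le> 1"
              using E_space_power_le[OF moser_in_E_space[OF j, of N], of s] N s by (simp add: f_def)
            then have "h j s \<le> (exp 1 / s) powr 1"
              unfolding h_def by (intro exp_mult_ln_le_powr s) simp
            also have "\<dots> = exp 1 / s" using s by simp
            also have "\<dots> \<le> 2 * exp 1 * real j"
            proof -
              have "1 \<le> 2 * (s * real j)" using js \<delta> by linarith
              then have "exp 1 * 1 \<le> exp 1 * (2 * (s * real j))" by (intro mult_left_mono) auto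
              then show ?thesis using s by (simp add: divide_le_eq mult_ac)
            qed
            finally show ?thesis .
          qed
          ultimately show ?thesis by (simp add: add_increasing ennreal_leI)
        qed (simp add: g_def)
      qed
      also have "\<dots> = (\<integral>\<^sup>+s. ennreal (g j s) \<partial>unit_interval_measure)
          + (\<integral>\<^sup>+s. ennreal (2 * exp 1 * real j) * indicator ?J s \<partial>unit_interval_measure)"
        by (rule nn_integral_add[OF gm[OF j]]; rule borel_measurable_lebesgue_on) measurable
      also have "(\<integral>\<^sup>+s. ennreal (2 * exp 1 * real j) * indicator ?J s \<partial>unit_interval_measure)
          \<le> ennreal (2 * exp 1 * real j * ((1 + \<delta>) / real j - (1 - \<delta>) / real j))"
        by (rule nn_integral_const_Icc) (use \<delta> in \<open>auto intro!: divide_right_mono\<close>)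
      also have "2 * exp 1 * real j * ((1 + \<delta>) / real j - (1 - \<delta>) / real j) = 4 * exp 1 * \<delta>"
        using j by (simp add: field_simps)
      also have "\<dots> \<le> (r - 1) / 2" by (rule \<delta>)
      finally show ?thesis by (simp add: add_left_mono ennreal_leI)
    qed
    have "(\<lambda>j. (\<integral>\<^sup>+s. ennreal (g j s) \<partial>unit_interval_measure) + ennreal ((r - 1) / 2)) \<longlonglongrightarrow> 1 + ennreal ((r - 1) / 2)"
      by (intro tendsto_add lim' tendsto_const)
    moreover have "1 + ennreal ((r - 1) / 2) < ennreal r"
    proof -
      have "1 + ennreal ((r - 1) / 2) = ennreal (1 + (r - 1) / 2)" using r by (subst ennreal_plus) auto
      also have "\<dots> < ennreal r" using r by (intro ennreal_lessI) (auto simp: field_simps)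
      finally show ?thesis .
    qed
    ultimately have "eventually (\<lambda>j. (\<integral>\<^sup>+s. ennreal (g j s) \<partial>unit_interval_measure) + ennreal ((r - 1) / 2) < ennreal r) sequentially"
      by (rule order_tendstoD)
    then show ?thesis
      using eventually_ge_at_top[of 1] by eventually_elim (use near in \<open>auto intro: le_less_trans\<close>)
  qed
  show ?thesis
  proof (rule order_tendstoI)
    fix a :: ennreal assume "a < 1"
    then show "eventually (\<lambda>j. a < I_fun N 1 (moser N j)) sequentially"
      using lower by (auto intro!: always_eventually intro: less_le_trans)
  next
    fix a :: ennreal assume "1 < a"
    \<comment> \<open>The bound \<open>a\<close> may be infinite; a value strictly in between is a
      real number, to which \<open>upper\<close> applies.\<close>
    then obtain b where b: "1 < b" "b < a" using dense by blast
    then obtain r where r: "b = ennreal r" "r \<ge> 0" by (cases b) auto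
    then have "r > 1" using b by (metis ennreal_1 ennreal_less_iff zero_le_one)
    from upper[OF this] show "eventually (\<lambda>j. I_fun N 1 (moser N j) < a) sequentially"
      by eventually_elim (use b r in \<open>auto intro: less_trans\<close>)
  qed
qed

theorem theorem1p3:
  fixes N :: nat
  assumes "N \<ge> 2"
  shows "(\<forall>\<beta>::real. (SUP v\<in>E_space N. I_fun N \<beta> v) < \<infinity> \<longleftrightarrow> \<beta> \<le> 1) \<and>
    (\<forall>\<beta><1. \<forall>U u. (\<forall>n. U n \<in> E_space N) \<longrightarrow> sobolev_weak_conv N U u \<longrightarrow>
        (\<lambda>n. I_fun N \<beta> (U n)) \<longlonglongrightarrow> I_fun N \<beta> u) \<and>
    ((\<lambda>j. I_fun N 1 (moser N j)) \<longlonglongrightarrow> 1 \<and> I_fun N 1 (\<lambda>_. 0) = 1) \<and>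
    (\<forall>\<beta>>1. (\<lambda>j. I_fun N \<beta> (moser N j)) \<longlonglongrightarrow> \<infinity>)"
proof (intro conjI allI impI)
  have N: "N \<ge> 1" using assms by simp
  fix \<beta> :: real
  show "(SUP v\<in>E_space N. I_fun N \<beta> v) < \<infinity> \<longleftrightarrow> \<beta> \<le> 1"
  proof
    assume fin: "(SUP v\<in>E_space N. I_fun N \<beta> v) < \<infinity>"
    show "\<beta> \<le> 1"
    proof (rule ccontr)
      assume "\<not> \<beta> \<le> 1"
      then have "(\<lambda>j. I_fun N \<beta> (moser N j)) \<longlonglongrightarrow> \<infinity>"
        by (intro I_fun_moser_tendsto_infinity N) simp
      \<comment> \<open>From \<open>j = 1\<close> on, the Moser functions belong to
        \<open>E_space N\<close>, so the supremum dominates the limit.\<close>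
      then have "\<infinity> \<le> (SUP v\<in>E_space N. I_fun N \<beta> v)"
        by (rule LIMSEQ_le_const2)
          (auto intro!: exI[of _ 1] SUP_upper moser_in_E_space N simp del: infinity_ennreal_def)
      then show False using fin by simp
    qed
  next
    assume "\<beta> \<le> 1"
    obtain C where "C < \<infinity>" and C: "\<And>\<beta> v. \<beta> \<le> 1 \<Longrightarrow> v \<in> E_space N \<Longrightarrow> I_fun N \<beta> v \<le> C"
      using I_fun_bounded[OF assms] by blast
    have "(SUP v\<in>E_space N. I_fun N \<beta> v) \<le> C"
      by (rule SUP_least) (rule C[OF \<open>\<beta> \<le> 1\<close>])
    then show "(SUP v\<in>E_space N. I_fun N \<beta> v) < \<infinity>"
      using \<open>C < \<infinity>\<close> by (rule le_less_trans)
  qed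
next
  show "(\<lambda>j. I_fun N 1 (moser N j)) \<longlonglongrightarrow> 1"
    by (rule I_fun_moser_tendsto_1[OF assms])
  show "I_fun N 1 (\<lambda>_. 0) = 1"
    by (rule I_fun_zero) (use assms in simp)
qed (use assms in \<open>auto intro: I_fun_weakly_continuous I_fun_moser_tendsto_infinity simp del: infinity_ennreal_def\<close>)

end
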